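(* Let $F$ be a field and let $q,n,e\in\mathbb{N}$ with $q>1$ and $e\mid q^n-1$, and put $m=m(q,e)$. If $e$ divides $\Phi_d(q)$ for some $d\in\{1,2,3,4,5\}$, then $$\mathrm{LL}(A(q,n,e))=\left\lfloor n\frac{q-1}{m}\right\rfloor+1.$$
   Context: $\mathbb{N}$ denotes the set of positive integers, $\mathbb{N}_0=\mathbb{N}\cup\{0\}$. $\Phi_d(X)\in\mathbb{Q}[X]$ denotes the $d$-th cyclotomic polynomial. For $q,e\in\mathbb{N}$ with $\gcd(q,e)=1$, $m(q,e)$ is the smallest positive integer $t$ such that there exist $i_1,\dots,i_t\in\mathbb{N}_0$ (repetitions allowed) with $e\mid q^{i_1}+\dots+q^{i_t}$. For a field $F$ and $q,n,e\in\mathbb{N}$ with $q>1$ and $e\mid q^n-1$, let $I=(X_1^q,\dots,X_n^q)$ in the polynomial algebra $F[X_1,\dots,X_n]$ and $x_j=X_j+I$. Then $A(q,n,e)$ is the unital $F$-subalgebra of $F[x_1,\dots,x_n]=F[X_1,\dots,X_n]/I$ generated by all monomials $x_1^{i_1}\cdots x_n^{i_n}$ with $i_1+qi_2+\dots+q^{n-1}i_n\equiv 0\pmod e$. For a finite-dimensional algebra $A$ with Jacobson radical $\mathrm{J}(A)$, the Loewy length $\mathrm{LL}(A)$ is the smallest $l\in\mathbb{N}_0$ with $\mathrm{J}(A)^l=0$. *)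

theory Defs
  imports
    "HOL-Library.Poly_Mapping"
    "HOL-Computational_Algebra.Polynomial"
    "HOL-Algebra.QuotRing"
    "HOL-Algebra.Generated_Rings"
    "HOL-Algebra.Ideal_Product"
begin

(* Usually the coefficients are rational; here the polynomial is formed over the
   complex numbers as the product of X - z over the primitive d-th roots of unity z. *)
definition cyclotomic :: "nat \<Rightarrow> complex poly" where
  "cyclotomic d = (\<Prod>z\<in>{z::complex. z ^ d = 1 \<and> (\<forall>k\<in>{1..<d}. z ^ k \<noteq> 1)}. [:- z, 1:])"

(* The exponents i_1, ..., i_t are the entries of a list of length t. *)
definition min_power_sum :: "nat \<Rightarrow> nat \<Rightarrow> nat" where
  "min_power_sum q e =
     (LEAST t. t > 0 \<and> (\<exists>js::nat list. length js = t \<and> e dvd (\<Sum>j\<leftarrow>js. q ^ j)))"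

(* F[X_1, ..., X_n]: a polynomial maps exponent vectors to coefficients, both with
   finite support, and only the variables with index in {1..n} may occur. *)
definition mpoly_ring :: "nat \<Rightarrow> ((nat \<Rightarrow>\<^sub>0 nat) \<Rightarrow>\<^sub>0 'a::field) ring" where
  "mpoly_ring n = \<lparr>carrier = {p. \<forall>i\<in>Poly_Mapping.keys p. Poly_Mapping.keys i \<subseteq> {1..n}},
     mult = (*), one = 1, zero = 0, add = (+)\<rparr>"

definition mpoly_monomial :: "(nat \<Rightarrow>\<^sub>0 nat) \<Rightarrow> (nat \<Rightarrow>\<^sub>0 nat) \<Rightarrow>\<^sub>0 'a::field" where
  "mpoly_monomial i = Poly_Mapping.single i 1"

definition mpoly_const :: "'a::field \<Rightarrow> (nat \<Rightarrow>\<^sub>0 nat) \<Rightarrow>\<^sub>0 'a" where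
  "mpoly_const c = Poly_Mapping.single 0 c"

definition power_ideal :: "nat \<Rightarrow> nat \<Rightarrow> ((nat \<Rightarrow>\<^sub>0 nat) \<Rightarrow>\<^sub>0 'a::field) set" where
  "power_ideal q n =
     genideal (mpoly_ring n) {mpoly_monomial (Poly_Mapping.single j 1) ^ q | j. j \<in> {1..n}}"

definition truncated_ring :: "nat \<Rightarrow> nat \<Rightarrow> ((nat \<Rightarrow>\<^sub>0 nat) \<Rightarrow>\<^sub>0 'a::field) set ring" where
  "truncated_ring q n = mpoly_ring n Quot power_ideal q n"

definition residue_class ::
  "nat \<Rightarrow> nat \<Rightarrow> ((nat \<Rightarrow>\<^sub>0 nat) \<Rightarrow>\<^sub>0 'a::field) \<Rightarrow> ((nat \<Rightarrow>\<^sub>0 nat) \<Rightarrow>\<^sub>0 'a) set" where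
  "residue_class q n p = power_ideal q n +>\<^bsub>mpoly_ring n\<^esub> p"

(* A unital subalgebra is a subring containing the scalars, so the unital subalgebra
   generated by a set is the subring generated by that set and the scalars. *)
definition alg_A :: "nat \<Rightarrow> nat \<Rightarrow> nat \<Rightarrow> ((nat \<Rightarrow>\<^sub>0 nat) \<Rightarrow>\<^sub>0 'a::field) set ring" where
  "alg_A q n e = (truncated_ring q n)\<lparr>carrier := generate_ring (truncated_ring q n)
     (range (\<lambda>c. residue_class q n (mpoly_const c)) \<union>
      {residue_class q n (mpoly_monomial i) | i. Poly_Mapping.keys i \<subseteq> {1..n} \<and>
         e dvd (\<Sum>j=1..n. q ^ (j - 1) * Poly_Mapping.lookup i j)})\<rparr>"

(* For commutative R only: two-sided and one-sided maximal ideals coincide there. *)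
definition jacobson_radical :: "('a, 'b) ring_scheme \<Rightarrow> 'a set" where
  "jacobson_radical R = {x \<in> carrier R. \<forall>M. maximalideal M R \<longrightarrow> x \<in> M}"

(* Powers are taken in the monoid of ideals; the 0-th power of an ideal is the ring. *)
definition loewy_length :: "('a, 'b) ring_scheme \<Rightarrow> nat" where
  "loewy_length R =
     (LEAST l::nat. jacobson_radical R [^]\<^bsub>ideals_set R\<^esub> l = {\<zero>\<^bsub>R\<^esub>})"

end

(* Modulo (X_1^q, ..., X_n^q) only the exponent vectors with all entries below q survive, so
   J(A) is spanned by the surviving admissible monomials other than 1, and LL(A) - 1 is the
   largest t such that t nonzero admissible exponent vectors have a sum with all entries
   below q. An admissible vector of total degree s yields a sum of s powers of q divisible
   by e, so s >= m and t <= n (q - 1) / m.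

   For the converse let d be the order of q modulo e, so that n = d k. Only the residues of
   exponents modulo d matter, and the bound becomes k (q - 1) uses of each residue. If d = 1
   then m = e divides q - 1. Otherwise 1 + q + ... + q^(d-1) = 0 modulo e, respectively
   1 + q^2 = 0 for d = 4, is a shortest relation unless d = 5 and m is 3 or 4. In that case
   the five cyclic shifts of a relation of length m use every residue m times, and the
   remaining fewer than m uses of each residue are filled by hand. *)
theory Submission
  imports Defs
    "HOL-Number_Theory.Cong"
    "HOL-Number_Theory.Pocklington"
    "HOL-Computational_Algebra.Fundamental_Theorem_Algebra"
begin

section \<open>The radical powers of \<open>A(q,n,e)\<close>\<close>

text \<open>The polynomial ring, the ideal of q-th powers and the lifts of A and J(A) are spans of
  monomials, so membership is a predicate on exponents and total degree controls the powers of the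
  radical.

  The cyclotomic hypothesis supplies a relation and also the order of q. For d = 2, 3, 5 it makes
  the order a divisor of the prime d; for d = 4 it gives q^2 = -1 modulo e, hence order 4 unless e
  divides 2. Order 1 is not excluded (e may equal d), which is why the case q = 1 modulo e is split
  off.

  The obstacle is the floor: every residue has its own capacity, yet the relations must come as
  close to filling all of it as the total count allows. If m = d, or m = 2 with d = 4, relations of
  length m tile the residues and nothing is lost. For d = 5 and m = 3 or 4 no such tiling exists, as
  m does not divide 5, and shifts are exact only for capacities divisible by m. The tight remainder
  is m = 3 with two uses of each residue left: three relations must fit into ten places, which
  requires knowing the shape of a relation of length 3.\<close>

definition supported :: "('b \<Rightarrow> bool) \<Rightarrow> ('b \<Rightarrow>\<^sub>0 'a::zero) set" where
  "supported P = {p. \<forall>i\<in>Poly_Mapping.keys p. P i}"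

lemma supported_zero [simp]: "0 \<in> supported P"
  by (simp add: supported_def)

lemma supported_single: "P i \<Longrightarrow> Poly_Mapping.single i c \<in> supported P"
  by (auto simp: supported_def)

lemma supported_one: "P 0 \<Longrightarrow> 1 \<in> supported P"
  by (metis single_one supported_single)

lemma supported_add:
  "p \<in> supported P \<Longrightarrow> r \<in> supported P \<Longrightarrow> p + r \<in> supported P"
  for p r :: "'b \<Rightarrow>\<^sub>0 'a::monoid_add"
  using keys_add[of p r] by (auto simp: supported_def)

lemma supported_uminus: "p \<in> supported P \<Longrightarrow> - p \<in> supported P"
  for p :: "'b \<Rightarrow>\<^sub>0 'a::ab_group_add"
  by (auto simp: supported_def in_keys_iff)

lemma supported_mult:
  fixes p r :: "'b::monoid_add \<Rightarrow>\<^sub>0 'a::semiring_0"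
  assumes "p \<in> supported P" "r \<in> supported Q" "\<And>i j. P i \<Longrightarrow> Q j \<Longrightarrow> T (i + j)"
  shows "p * r \<in> supported T"
  using keys_mult[of p r] assms by (fastforce simp: supported_def)

lemma supported_mono: "p \<in> supported P \<Longrightarrow> (\<And>i. P i \<Longrightarrow> Q i) \<Longrightarrow> p \<in> supported Q"
  by (auto simp: supported_def)

text \<open>A polynomial is the finite sum of its terms, whose exponents all satisfy
  \<open>P\<close>, so closure under addition and the single terms suffice.\<close>

lemma supported_induct [consumes 1, case_names zero add single]:
  fixes p :: "'b \<Rightarrow>\<^sub>0 'a::comm_monoid_add"
  assumes "p \<in> supported P" "X 0" "\<And>p r. X p \<Longrightarrow> X r \<Longrightarrow> X (p + r)"
    and "\<And>i c. P i \<Longrightarrow> X (Poly_Mapping.single i c)"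
  shows "X p"
proof -
  have "X (\<Sum>i\<in>S. Poly_Mapping.single i (Poly_Mapping.lookup p i))"
    if "finite S" "S \<subseteq> Poly_Mapping.keys p" for S
    using that by (induction S) (use assms in \<open>auto simp: supported_def\<close>)
  moreover have "p = (\<Sum>i\<in>Poly_Mapping.keys p. Poly_Mapping.single i (Poly_Mapping.lookup p i))"
    by (intro poly_mapping_eqI)
       (auto simp: lookup_sum lookup_single when_def in_keys_iff sum.delta)
  ultimately show ?thesis
    by (metis finite_keys subset_refl)
qed

section \<open>Exponent vectors and their degrees\<close>

definition in_vars :: "nat \<Rightarrow> (nat \<Rightarrow>\<^sub>0 nat) \<Rightarrow> bool" where
  "in_vars n i \<longleftrightarrow> Poly_Mapping.keys i \<subseteq> {1..n}"

definition reduced :: "nat \<Rightarrow> nat \<Rightarrow> (nat \<Rightarrow>\<^sub>0 nat) \<Rightarrow> bool" where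
  "reduced q n i \<longleftrightarrow> (\<forall>j\<in>{1..n}. Poly_Mapping.lookup i j < q)"

definition admissible :: "nat \<Rightarrow> nat \<Rightarrow> nat \<Rightarrow> (nat \<Rightarrow>\<^sub>0 nat) \<Rightarrow> bool" where
  "admissible q n e i \<longleftrightarrow>
     in_vars n i \<and> e dvd (\<Sum>j=1..n. q ^ (j - 1) * Poly_Mapping.lookup i j)"

definition total_degree :: "nat \<Rightarrow> (nat \<Rightarrow>\<^sub>0 nat) \<Rightarrow> nat" where
  "total_degree n i = (\<Sum>j=1..n. Poly_Mapping.lookup i j)"

lemma in_vars_zero [simp]: "in_vars n 0"
  by (simp add: in_vars_def)

lemma in_vars_add: "in_vars n i \<Longrightarrow> in_vars n j \<Longrightarrow> in_vars n (i + j)"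
  using keys_add[of i j] by (auto simp: in_vars_def)

lemma admissible_zero [simp]: "admissible q n e 0"
  by (simp add: admissible_def)

lemma admissible_add: "admissible q n e i \<Longrightarrow> admissible q n e j \<Longrightarrow> admissible q n e (i + j)"
  by (auto simp: admissible_def in_vars_add lookup_add ring_distribs sum.distrib)

lemma total_degree_zero [simp]: "total_degree n 0 = 0"
  by (simp add: total_degree_def)

lemma total_degree_add: "total_degree n (i + j) = total_degree n i + total_degree n j"
  by (simp add: total_degree_def lookup_add sum.distrib)

text \<open>Serves two purposes: contrapositively, a monomial that is not reduced stays so under
  multiplication; directly, partial sums of a reduced sum are reduced.\<close>

lemma reduced_addD: "reduced q n (i + j) \<Longrightarrow> reduced q n i"
  by (auto simp: reduced_def lookup_add intro: le_less_trans[OF le_add1])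

lemma total_degree_eq_0_iff: "in_vars n i \<Longrightarrow> total_degree n i = 0 \<longleftrightarrow> i = 0"
proof
  assume i: "in_vars n i" "total_degree n i = 0"
  show "i = 0"
  proof (rule poly_mapping_eqI)
    fix j
    show "Poly_Mapping.lookup i j = Poly_Mapping.lookup 0 j"
    proof (cases "j \<in> {1..n}")
      case False
      then have "j \<notin> Poly_Mapping.keys i"
        using i by (auto simp: in_vars_def)
      then show ?thesis
        by (simp add: in_keys_iff)
    qed (use i in \<open>simp add: total_degree_def\<close>)
  qed
qed (simp add: total_degree_def)

lemma total_degree_reduced_le:
  assumes "reduced q n i"
  shows "total_degree n i \<le> n * (q - 1)"
proof -
  have "total_degree n i \<le> (\<Sum>j=1..n. q - 1)"
    unfolding total_degree_def
  proof (intro sum_mono)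
    fix j assume "j \<in> {1..n}"
    then have "Poly_Mapping.lookup i j < q"
      using assms by (simp add: reduced_def)
    then show "Poly_Mapping.lookup i j \<le> q - 1"
      by simp
  qed
  then show ?thesis
    by simp
qed

section \<open>The polynomial ring and its ideal of q-th powers\<close>

lemma carrier_mpoly_ring: "carrier (mpoly_ring n) = supported (in_vars n)"
  by (auto simp: mpoly_ring_def supported_def in_vars_def)

lemma mpoly_ring_simps [simp]:
  "p \<oplus>\<^bsub>mpoly_ring n\<^esub> r = p + r" "p \<otimes>\<^bsub>mpoly_ring n\<^esub> r = p * r"
  "\<zero>\<^bsub>mpoly_ring n\<^esub> = 0" "\<one>\<^bsub>mpoly_ring n\<^esub> = 1"
  by (auto simp: mpoly_ring_def)

lemma cring_mpoly_ring: "cring (mpoly_ring n :: ((nat \<Rightarrow>\<^sub>0 nat) \<Rightarrow>\<^sub>0 'a::field) ring)"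
proof (rule cringI)
  show "abelian_group (mpoly_ring n :: ((nat \<Rightarrow>\<^sub>0 nat) \<Rightarrow>\<^sub>0 'a) ring)"
  proof (rule abelian_groupI)
    fix p :: "(nat \<Rightarrow>\<^sub>0 nat) \<Rightarrow>\<^sub>0 'a"
    assume "p \<in> carrier (mpoly_ring n)"
    then show "\<exists>r\<in>carrier (mpoly_ring n). r \<oplus>\<^bsub>mpoly_ring n\<^esub> p = \<zero>\<^bsub>mpoly_ring n\<^esub>"
      by (intro bexI[of _ "- p"]) (auto simp: carrier_mpoly_ring supported_uminus)
  qed (auto simp: carrier_mpoly_ring intro: supported_add)
  show "comm_monoid (mpoly_ring n :: ((nat \<Rightarrow>\<^sub>0 nat) \<Rightarrow>\<^sub>0 'a) ring)"
    by (rule comm_monoidI)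
       (auto simp: carrier_mpoly_ring mult_ac in_vars_add intro: supported_mult supported_one)
qed (auto simp: ring_distribs)

lemma a_inv_mpoly_ring:
  assumes "p \<in> carrier (mpoly_ring n)"
  shows "\<ominus>\<^bsub>mpoly_ring n\<^esub> p = - p"
proof -
  interpret cring "mpoly_ring n" by (rule cring_mpoly_ring)
  show ?thesis
    using assms by (intro minus_equality) (auto simp: carrier_mpoly_ring supported_uminus)
qed

text \<open>Additive inverses come from multiplication by \<open>- 1\<close>.\<close>

lemma mpoly_ring_idealI:
  assumes "I \<subseteq> carrier (mpoly_ring n)" "0 \<in> I"
    and "\<And>p r. p \<in> I \<Longrightarrow> r \<in> I \<Longrightarrow> p + r \<in> I"
    and "\<And>p r. p \<in> I \<Longrightarrow> r \<in> carrier (mpoly_ring n) \<Longrightarrow> p * r \<in> I"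
  shows "ideal I (mpoly_ring n)"
proof -
  interpret cring "mpoly_ring n" by (rule cring_mpoly_ring)
  have m1: "- 1 \<in> carrier (mpoly_ring n)"
    by (simp add: carrier_mpoly_ring supported_uminus supported_one)
  show ?thesis
  proof (rule idealI)
    show "subgroup I (add_monoid (mpoly_ring n))"
    proof (rule add.subgroupI)
      fix p assume "p \<in> I"
      then show "\<ominus>\<^bsub>mpoly_ring n\<^esub> p \<in> I"
        using assms(4)[OF _ m1, of p] assms(1) by (auto simp: a_inv_mpoly_ring)
    qed (use assms in auto)
  qed (use assms in \<open>auto simp: mult.commute ring_axioms\<close>)
qed

lemma power_mpoly_monomial: "mpoly_monomial (Poly_Mapping.single j 1) ^ k =
    (mpoly_monomial (Poly_Mapping.single j k) :: (nat \<Rightarrow>\<^sub>0 nat) \<Rightarrow>\<^sub>0 'a::field)"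
  by (induction k) (auto simp: mpoly_monomial_def mult_single single_one simp flip: single_add)

text \<open>A monomial ideal is spanned by the monomials divisible by one of its generators, and
  divisibility by some X_j^q is exactly the failure of \<open>reduced\<close>.\<close>

lemma power_ideal_eq:
  "(power_ideal q n :: ((nat \<Rightarrow>\<^sub>0 nat) \<Rightarrow>\<^sub>0 'a::field) set) =
     supported (\<lambda>i. in_vars n i \<and> \<not> reduced q n i)"
    (is "_ = ?U")
proof -
  define R :: "((nat \<Rightarrow>\<^sub>0 nat) \<Rightarrow>\<^sub>0 'a) ring" where "R = mpoly_ring n"
  define G :: "((nat \<Rightarrow>\<^sub>0 nat) \<Rightarrow>\<^sub>0 'a) set"
    where "G = {mpoly_monomial (Poly_Mapping.single j q) | j. j \<in> {1..n}}"
  interpret cring R unfolding R_def by (rule cring_mpoly_ring)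
  have I: "power_ideal q n = genideal R G"
    by (simp only: power_ideal_def R_def G_def power_mpoly_monomial)
  have G: "G \<subseteq> ?U"
  proof
    fix p assume "p \<in> G"
    then obtain j where j: "j \<in> {1..n}" and p: "p = mpoly_monomial (Poly_Mapping.single j q)"
      by (auto simp: G_def)
    have "in_vars n (Poly_Mapping.single j q)"
      using j by (auto simp: in_vars_def)
    moreover have "\<not> reduced q n (Poly_Mapping.single j q)"
      using j by (auto simp: reduced_def intro!: bexI[of _ j])
    ultimately show "p \<in> ?U"
      by (simp add: p mpoly_monomial_def supported_single)
  qed
  have U: "?U \<subseteq> carrier R"
    by (auto simp: R_def carrier_mpoly_ring supported_def)
  have ideal_U: "ideal ?U R"
    unfolding R_def
  proof (rule mpoly_ring_idealI)
    show "p * r \<in> ?U" if "p \<in> ?U" "r \<in> carrier (mpoly_ring n)" for p r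
      using that unfolding carrier_mpoly_ring
      by (rule supported_mult) (auto simp: in_vars_add dest: reduced_addD)
  qed (use U in \<open>auto simp: R_def intro: supported_add\<close>)
  interpret I: ideal "genideal R G" R
    using G U by (intro genideal_ideal) auto
  have "p \<in> genideal R G" if "p \<in> ?U" for p
    using that
  proof (induction rule: supported_induct)
    case zero
    then show ?case using I.zero_closed by (simp add: R_def)
  next
    case (add p r)
    then show ?case using I.a_closed by (simp add: R_def)
  next
    case (single i c)
    then obtain j where j: "j \<in> {1..n}" "q \<le> Poly_Mapping.lookup i j" and i: "in_vars n i"
      by (auto simp: reduced_def not_less)
    define i' where "i' = i - Poly_Mapping.single j q"
    have "i = Poly_Mapping.single j q + i'"
      unfolding i'_def
      by (rule poly_mapping_eqI) (use j in \<open>auto simp: lookup_add lookup_minus lookup_single when_def\<close>)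
    then have "Poly_Mapping.single i c =
        mpoly_monomial (Poly_Mapping.single j q) * Poly_Mapping.single i' c"
      by (simp add: mpoly_monomial_def mult_single)
    moreover have "in_vars n i'"
      using i by (auto simp: in_vars_def i'_def in_keys_iff lookup_minus)
    then have "Poly_Mapping.single i' c \<in> carrier R"
      by (auto simp: R_def carrier_mpoly_ring intro: supported_single)
    moreover have "mpoly_monomial (Poly_Mapping.single j q) \<in> genideal R G"
      using j genideal_self[of G] G U by (auto simp: G_def)
    ultimately show ?case
      using I.I_r_closed by (fastforce simp: R_def)
  qed
  moreover have "genideal R G \<subseteq> ?U"
    using ideal_U G by (rule genideal_minimal)
  ultimately show ?thesis
    unfolding I by blast
qed


(* Modulo the power ideal, k = 0 represents A and k = 1 its Jacobson radical. *)
definition adm_poly :: "nat \<Rightarrow> nat \<Rightarrow> nat \<Rightarrow> nat \<Rightarrow> ((nat \<Rightarrow>\<^sub>0 nat) \<Rightarrow>\<^sub>0 'a::field) set" where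
  "adm_poly q n e k = supported (\<lambda>i. admissible q n e i \<and> k \<le> total_degree n i)"

lemma adm_poly_carrier: "adm_poly q n e k \<subseteq> carrier (mpoly_ring n)"
  by (auto simp: adm_poly_def carrier_mpoly_ring supported_def admissible_def)

lemma adm_poly_antimono: "k \<le> l \<Longrightarrow> adm_poly q n e l \<subseteq> adm_poly q n e k"
  by (auto simp: adm_poly_def elim: supported_mono)

lemma adm_poly_zero [simp]: "0 \<in> adm_poly q n e k"
  by (simp add: adm_poly_def)

lemma adm_poly_one [simp]: "1 \<in> adm_poly q n e 0"
  by (simp add: adm_poly_def supported_one)

lemma adm_poly_add:
  "p \<in> adm_poly q n e k \<Longrightarrow> r \<in> adm_poly q n e k \<Longrightarrow> p + r \<in> adm_poly q n e k"
  by (simp add: adm_poly_def supported_add)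

lemma adm_poly_uminus: "p \<in> adm_poly q n e k \<Longrightarrow> - p \<in> adm_poly q n e k"
  by (simp add: adm_poly_def supported_uminus)

lemma adm_poly_mult:
  assumes "p \<in> adm_poly q n e k" "r \<in> adm_poly q n e l"
  shows "p * r \<in> adm_poly q n e (k + l)"
  using assms unfolding adm_poly_def
  by (rule supported_mult) (auto simp: admissible_add total_degree_add)

text \<open>Only the exponent 0 has total degree 0, so A is the sum of the scalars and the span of
  the other admissible monomials. This is what makes that span a maximal ideal.\<close>

lemma adm_poly_0_split:
  assumes "p \<in> adm_poly q n e 0"
  shows "p - mpoly_const (Poly_Mapping.lookup p 0) \<in> adm_poly q n e 1"
proof -
  have "admissible q n e i \<and> 1 \<le> total_degree n i"
    if i: "i \<in> Poly_Mapping.keys (p - mpoly_const (Poly_Mapping.lookup p 0))" for i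
  proof -
    have "i \<noteq> 0" "i \<in> Poly_Mapping.keys p"
      using i by (auto simp: in_keys_iff lookup_minus mpoly_const_def lookup_single when_def split: if_splits)
    moreover from this have "admissible q n e i"
      using assms by (auto simp: adm_poly_def supported_def)
    ultimately show ?thesis
      using total_degree_eq_0_iff[of n i] by (auto simp: admissible_def)
  qed
  then show ?thesis
    by (simp add: adm_poly_def supported_def)
qed

lemma mpoly_const_adm_poly: "mpoly_const c \<in> adm_poly q n e 0"
  by (simp add: mpoly_const_def adm_poly_def supported_single)

section \<open>Residue classes and the carrier of A(q,n,e)\<close>

lemma ideal_power_ideal: "ideal (power_ideal q n) (mpoly_ring n)"
proof -
  interpret cring "mpoly_ring n" by (rule cring_mpoly_ring)
  show ?thesis
    unfolding power_ideal_def power_mpoly_monomial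
    by (intro genideal_ideal)
      (auto simp: carrier_mpoly_ring mpoly_monomial_def in_vars_def intro!: supported_single)
qed

lemma cring_truncated_ring:
  "cring (truncated_ring q n :: ((nat \<Rightarrow>\<^sub>0 nat) \<Rightarrow>\<^sub>0 'a::field) set ring)"
  unfolding truncated_ring_def
  by (intro ideal.quotient_is_cring ideal_power_ideal cring_mpoly_ring)

lemma residue_class_hom: "residue_class q n \<in> ring_hom (mpoly_ring n) (truncated_ring q n)"
  using ideal.rcos_ring_hom[OF ideal_power_ideal]
  by (simp add: truncated_ring_def residue_class_def[abs_def])

lemma residue_class_eq_iff:
  assumes "p \<in> carrier (mpoly_ring n)" "r \<in> carrier (mpoly_ring n)"
  shows "residue_class q n p = residue_class q n r \<longleftrightarrow> p - r \<in> power_ideal q n"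
proof -
  interpret cring "mpoly_ring n" by (rule cring_mpoly_ring)
  show ?thesis
    unfolding residue_class_def
    using quotient_eq_iff_same_a_r_cos[OF ideal_power_ideal assms] assms
    by (simp add: a_minus_def a_inv_mpoly_ring)
qed

lemma
  assumes "p \<in> carrier (mpoly_ring n)" "r \<in> carrier (mpoly_ring n)"
  shows residue_class_add:
      "residue_class q n p \<oplus>\<^bsub>truncated_ring q n\<^esub> residue_class q n r = residue_class q n (p + r)"
    and residue_class_mult:
      "residue_class q n p \<otimes>\<^bsub>truncated_ring q n\<^esub> residue_class q n r = residue_class q n (p * r)"
  using ring_hom_add[OF residue_class_hom assms] ring_hom_mult[OF residue_class_hom assms]
  by simp_all

lemma residue_class_one: "\<one>\<^bsub>truncated_ring q n\<^esub> = residue_class q n 1"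
  using ring_hom_one[OF residue_class_hom, symmetric] by simp

lemma residue_class_zero: "\<zero>\<^bsub>truncated_ring q n\<^esub> = residue_class q n 0"
  using ring_hom_zero[OF residue_class_hom cring.axioms(1)[OF cring_mpoly_ring]
      cring.axioms(1)[OF cring_truncated_ring], symmetric] by simp

lemma residue_class_uminus:
  assumes "p \<in> carrier (mpoly_ring n)"
  shows "\<ominus>\<^bsub>truncated_ring q n\<^esub> residue_class q n p = residue_class q n (- p)"
proof -
  interpret T: cring "truncated_ring q n" by (rule cring_truncated_ring)
  have "- p \<in> carrier (mpoly_ring n)"
    using assms by (simp add: carrier_mpoly_ring supported_uminus)
  then show ?thesis
    using assms ring_hom_closed[OF residue_class_hom]
    by (intro T.minus_equality) (auto simp: residue_class_add residue_class_zero)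
qed

lemma adm_polyD: "p \<in> adm_poly q n e k \<Longrightarrow> p \<in> carrier (mpoly_ring n)"
  using adm_poly_carrier by blast

lemma residue_class_image_add:
  assumes "x \<in> residue_class q n ` adm_poly q n e k" "y \<in> residue_class q n ` adm_poly q n e k"
  shows "x \<oplus>\<^bsub>truncated_ring q n\<^esub> y \<in> residue_class q n ` adm_poly q n e k"
proof -
  obtain p r where *: "p \<in> adm_poly q n e k" "r \<in> adm_poly q n e k"
    "x = residue_class q n p" "y = residue_class q n r"
    using assms by blast
  show ?thesis
    unfolding *(3,4) residue_class_add[OF *(1,2)[THEN adm_polyD]]
    by (intro imageI adm_poly_add *)
qed

lemma residue_class_image_mult:
  assumes "x \<in> residue_class q n ` adm_poly q n e k" "y \<in> residue_class q n ` adm_poly q n e l"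
  shows "x \<otimes>\<^bsub>truncated_ring q n\<^esub> y \<in> residue_class q n ` adm_poly q n e (k + l)"
proof -
  obtain p r where *: "p \<in> adm_poly q n e k" "r \<in> adm_poly q n e l"
    "x = residue_class q n p" "y = residue_class q n r"
    using assms by blast
  show ?thesis
    unfolding *(3,4) residue_class_mult[OF *(1,2)[THEN adm_polyD]]
    by (intro imageI adm_poly_mult *)
qed

lemma residue_class_image_uminus:
  assumes "x \<in> residue_class q n ` adm_poly q n e k"
  shows "\<ominus>\<^bsub>truncated_ring q n\<^esub> x \<in> residue_class q n ` adm_poly q n e k"
proof -
  obtain p where *: "p \<in> adm_poly q n e k" "x = residue_class q n p"
    using assms by blast
  show ?thesis
    unfolding *(2) residue_class_uminus[OF *(1)[THEN adm_polyD]]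
    by (intro imageI adm_poly_uminus *)
qed

lemma subring_adm_poly:
  "subring (residue_class q n ` adm_poly q n e 0)
     (truncated_ring q n :: ((nat \<Rightarrow>\<^sub>0 nat) \<Rightarrow>\<^sub>0 'a::field) set ring)"
proof -
  interpret T: cring "truncated_ring q n :: ((nat \<Rightarrow>\<^sub>0 nat) \<Rightarrow>\<^sub>0 'a) set ring"
    by (rule cring_truncated_ring)
  show ?thesis
  proof (rule T.subringI)
    show "residue_class q n ` adm_poly q n e 0 \<subseteq> carrier (truncated_ring q n)"
      using ring_hom_closed[OF residue_class_hom] by (auto dest: adm_polyD)
    show "\<one>\<^bsub>truncated_ring q n\<^esub> \<in> residue_class q n ` adm_poly q n e 0"
      by (auto simp: residue_class_one)
  qed (use residue_class_image_mult[where k = 0 and l = 0] in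
      \<open>simp_all add: residue_class_image_uminus residue_class_image_add\<close>)
qed

text \<open>Admissible exponents form a monoid, so the span of their monomials is already a subring.
  Conversely each of its terms is a scalar times a generator.\<close>

lemma carrier_alg_A:
  "carrier (alg_A q n e :: ((nat \<Rightarrow>\<^sub>0 nat) \<Rightarrow>\<^sub>0 'a::field) set ring) =
     residue_class q n ` adm_poly q n e 0"
    (is "_ = ?E")
proof -
  define T :: "((nat \<Rightarrow>\<^sub>0 nat) \<Rightarrow>\<^sub>0 'a) set ring" where "T = truncated_ring q n"
  interpret T: cring T unfolding T_def by (rule cring_truncated_ring)
  define H :: "((nat \<Rightarrow>\<^sub>0 nat) \<Rightarrow>\<^sub>0 'a) set set"
    where "H = range (\<lambda>c. residue_class q n (mpoly_const c)) \<union>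
      {residue_class q n (mpoly_monomial i) | i. admissible q n e i}"
  have H: "carrier (alg_A q n e) = generate_ring T H"
    by (simp add: alg_A_def T_def H_def admissible_def in_vars_def)
  have carr: "p \<in> carrier (mpoly_ring n)" if "p \<in> adm_poly q n e 0" for p :: "(nat \<Rightarrow>\<^sub>0 nat) \<Rightarrow>\<^sub>0 'a"
    using subsetD[OF adm_poly_carrier that] .
  have mono: "mpoly_monomial i \<in> adm_poly q n e 0" if "admissible q n e i" for i
    using that by (simp add: mpoly_monomial_def adm_poly_def supported_single)
  have HE: "H \<subseteq> ?E"
    by (auto simp: H_def intro!: imageI mpoly_const_adm_poly mono)
  have E: "?E \<subseteq> carrier T"
    using carr ring_hom_closed[OF residue_class_hom] by (auto simp: T_def)
  have "subring ?E T"
    unfolding T_def by (rule subring_adm_poly)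
  then have "generate_ring T H \<subseteq> ?E"
    using HE E by (intro T.generate_ring_min_subring1) auto
  moreover have "residue_class q n p \<in> generate_ring T H" if "p \<in> adm_poly q n e 0" for p
  proof -
    \<comment> \<open>Membership in the span is carried along, because
      \<open>residue_class_add\<close> applies only to representatives in the polynomial
      ring.\<close>
    have "p \<in> adm_poly q n e 0 \<and> residue_class q n p \<in> generate_ring T H"
      using that unfolding adm_poly_def[where k = 0]
    proof (induction rule: supported_induct)
      case zero
      then show ?case
        using T.zero_in_generate by (simp add: T_def residue_class_zero)
    next
      case (add p r)
      then show ?case
        using generate_ring.eng_add[of _ T H] carr
        by (fastforce simp: T_def residue_class_add supported_add adm_poly_def)
    next
      case (single i c)
      have "mpoly_const c * mpoly_monomial i = Poly_Mapping.single i c"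
        by (simp add: mpoly_const_def mpoly_monomial_def mult_single)
      moreover have "residue_class q n (mpoly_const c) \<otimes>\<^bsub>T\<^esub> residue_class q n (mpoly_monomial i)
          \<in> generate_ring T H"
        using single by (intro generate_ring.eng_mult generate_ring.incl) (auto simp: H_def)
      ultimately show ?case
        using single by (simp add: T_def residue_class_mult carr mono mpoly_const_adm_poly supported_single)
    qed
    then show ?thesis
      by blast
  qed
  ultimately show ?thesis
    unfolding H by blast
qed

lemma alg_A_simps [simp]:
  "mult (alg_A q n e) = mult (truncated_ring q n)" "add (alg_A q n e) = add (truncated_ring q n)"
  "one (alg_A q n e) = one (truncated_ring q n)" "zero (alg_A q n e) = zero (truncated_ring q n)"
  by (simp_all add: alg_A_def)


lemma cring_alg_A: "cring (alg_A q n e :: ((nat \<Rightarrow>\<^sub>0 nat) \<Rightarrow>\<^sub>0 'a::field) set ring)"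
proof -
  interpret T: cring "truncated_ring q n :: ((nat \<Rightarrow>\<^sub>0 nat) \<Rightarrow>\<^sub>0 'a) set ring"
    by (rule cring_truncated_ring)
  have "(alg_A q n e :: ((nat \<Rightarrow>\<^sub>0 nat) \<Rightarrow>\<^sub>0 'a) set ring) =
      (truncated_ring q n)\<lparr>carrier := carrier (alg_A q n e)\<rparr>"
    by (simp add: alg_A_def)
  then have "(alg_A q n e :: ((nat \<Rightarrow>\<^sub>0 nat) \<Rightarrow>\<^sub>0 'a) set ring) =
      (truncated_ring q n)\<lparr>carrier := residue_class q n ` adm_poly q n e 0\<rparr>"
    unfolding carrier_alg_A .
  then show ?thesis
    using T.subcringI'[OF subring_adm_poly] T.subcring_iff[OF subringE(1)[OF subring_adm_poly]]
    by metis
qed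

lemma residue_class_eq_zero_iff:
  assumes "p \<in> carrier (mpoly_ring n)"
  shows "residue_class q n p = \<zero>\<^bsub>truncated_ring q n\<^esub> \<longleftrightarrow> p \<in> power_ideal q n"
  using residue_class_eq_iff[OF assms, of 0] by (simp add: residue_class_zero carrier_mpoly_ring)

text \<open>Beyond the largest possible degree no reduced term survives. This yields both the
  nilpotency of the elements of J and the upper bound on the Loewy length.\<close>

lemma adm_poly_power_ideal:
  assumes "p \<in> adm_poly q n e k" "n * (q - 1) < k"
  shows "p \<in> power_ideal q n"
  using assms total_degree_reduced_le[of q n] unfolding adm_poly_def power_ideal_eq
  by (elim supported_mono) (force simp: admissible_def)

lemma ideal_adm_poly:
  "ideal (residue_class q n ` adm_poly q n e k)
     (alg_A q n e :: ((nat \<Rightarrow>\<^sub>0 nat) \<Rightarrow>\<^sub>0 'a::field) set ring)"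
proof -
  interpret A: cring "alg_A q n e :: ((nat \<Rightarrow>\<^sub>0 nat) \<Rightarrow>\<^sub>0 'a) set ring"
    by (rule cring_alg_A)
  let ?K = "residue_class q n ` adm_poly q n e k :: ((nat \<Rightarrow>\<^sub>0 nat) \<Rightarrow>\<^sub>0 'a) set set"
  have K: "?K \<subseteq> carrier (alg_A q n e)"
    using adm_poly_antimono[of 0 k q n e] by (auto simp: carrier_alg_A)
  have mult: "x \<otimes>\<^bsub>alg_A q n e\<^esub> a \<in> ?K" if "a \<in> ?K" "x \<in> carrier (alg_A q n e)" for a x
    using residue_class_image_mult[of x q n e 0 a k] that by (simp add: carrier_alg_A)
  show ?thesis
  proof (rule idealI)
    show "subgroup ?K (add_monoid (alg_A q n e))"
    proof (rule A.add.subgroupI)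
      fix a assume a: "a \<in> ?K"
      have "\<ominus>\<^bsub>alg_A q n e\<^esub> \<one>\<^bsub>alg_A q n e\<^esub> \<otimes>\<^bsub>alg_A q n e\<^esub> a \<in> ?K"
        using a by (rule mult) (rule A.a_inv_closed[OF A.one_closed])
      moreover have "\<ominus>\<^bsub>alg_A q n e\<^esub> \<one>\<^bsub>alg_A q n e\<^esub> \<otimes>\<^bsub>alg_A q n e\<^esub> a = \<ominus>\<^bsub>alg_A q n e\<^esub> a"
        using A.l_minus[OF A.one_closed subsetD[OF K a]] A.l_one[OF subsetD[OF K a]] by argo
      ultimately show "\<ominus>\<^bsub>alg_A q n e\<^esub> a \<in> ?K"
        by simp
    next
      show "?K \<noteq> {}"
        using adm_poly_zero by blast
    next
      fix a b assume "a \<in> ?K" "b \<in> ?K"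
      then show "a \<oplus>\<^bsub>alg_A q n e\<^esub> b \<in> ?K"
        by (simp add: residue_class_image_add)
    qed (use K in auto)
  next
    fix a x assume ax: "a \<in> ?K" "x \<in> carrier (alg_A q n e :: ((nat \<Rightarrow>\<^sub>0 nat) \<Rightarrow>\<^sub>0 'a) set ring)"
    then show "x \<otimes>\<^bsub>alg_A q n e\<^esub> a \<in> ?K"
      by (rule mult)
    then show "a \<otimes>\<^bsub>alg_A q n e\<^esub> x \<in> ?K"
      using A.m_comm[OF subsetD[OF K ax(1)] ax(2)] by argo
  qed (rule A.ring_axioms)
qed

section \<open>The Jacobson radical\<close>

lemma (in primeideal) power_mem_imp_mem:
  assumes "x \<in> carrier R" "x [^] (k::nat) \<in> I"
  shows "x \<in> I"
  using assms(2)
proof (induction k)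
  case 0
  then show ?case
    using one_imp_carrier I_notcarr by simp
next
  case (Suc k)
  then show ?case
    using I_prime[of "x [^] k" x] assms(1) by auto
qed

lemma residue_class_power:
  assumes "p \<in> adm_poly q n e 1"
  shows "p ^ k \<in> adm_poly q n e k \<and> residue_class q n p [^]\<^bsub>alg_A q n e\<^esub> k = residue_class q n (p ^ k)"
proof (induction k)
  case 0
  then show ?case
    by (simp add: residue_class_one nat_pow_def)
next
  case (Suc k)
  have eq: "p ^ Suc k = p ^ k * p"
    by (simp add: power_commutes)
  have "p ^ k * p \<in> adm_poly q n e (k + 1)"
    using Suc assms by (intro adm_poly_mult) auto
  moreover have "residue_class q n p [^]\<^bsub>alg_A q n e\<^esub> Suc k =
      residue_class q n p [^]\<^bsub>alg_A q n e\<^esub> k \<otimes>\<^bsub>alg_A q n e\<^esub> residue_class q n p"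
    by (simp add: nat_pow_def)
  ultimately show ?case
    unfolding eq using Suc residue_class_mult[of "p ^ k" n p q] adm_polyD[of "p ^ k" q n e k] adm_polyD[OF assms]
    by simp
qed

text \<open>An element outside \<open>?J\<close> has a nonzero constant term, so an ideal containing
  it and \<open>?J\<close> contains a unit; hence \<open>?J\<close> is maximal. Conversely the
  elements of \<open>?J\<close> are nilpotent and so lie in every prime ideal, in particular in
  every maximal one.\<close>

lemma jacobson_radical_alg_A:
  assumes "q > 0"
  shows "jacobson_radical (alg_A q n e :: ((nat \<Rightarrow>\<^sub>0 nat) \<Rightarrow>\<^sub>0 'a::field) set ring) =
    residue_class q n ` adm_poly q n e 1"
    (is "jacobson_radical ?A = ?J")
proof
  interpret A: cring ?A by (rule cring_alg_A)
  interpret J: ideal ?J ?A by (rule ideal_adm_poly)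
  \<comment> \<open>A representative \<open>p\<close> has no constant term, so the exponent 0 occurs
    in \<open>1 - p\<close>, and it is reduced because \<open>q > 0\<close>.\<close>
  have one_notin: "\<one>\<^bsub>?A\<^esub> \<notin> ?J"
  proof
    assume "\<one>\<^bsub>?A\<^esub> \<in> ?J"
    then obtain p where p: "p \<in> adm_poly q n e 1" "\<one>\<^bsub>?A\<^esub> = residue_class q n p"
      by blast
    then have "residue_class q n 1 = residue_class q n p"
      by (simp add: residue_class_one)
    then have "1 - p \<in> power_ideal q n"
      using residue_class_eq_iff[of 1 n p q] adm_polyD[OF p(1)] adm_polyD[OF adm_poly_one] by blast
    moreover have "0 \<notin> Poly_Mapping.keys p"
      using p by (auto simp: adm_poly_def supported_def total_degree_def)
    then have "0 \<in> Poly_Mapping.keys (1 - p)"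
      by (simp add: in_keys_iff lookup_minus)
    ultimately show False
      using assms by (auto simp: power_ideal_eq supported_def reduced_def)
  qed
  have "maximalideal ?J ?A"
  proof (rule maximalidealI)
    show "carrier ?A \<noteq> ?J"
      using one_notin A.one_closed by metis
  next
    fix K assume K: "ideal K ?A" "?J \<subseteq> K" "K \<subseteq> carrier ?A"
    interpret K: ideal K ?A by (rule K)
    show "K = ?J \<or> K = carrier ?A"
    proof (cases "K \<subseteq> ?J")
      case False
      then obtain p where p: "p \<in> adm_poly q n e 0" "residue_class q n p \<in> K"
        "residue_class q n p \<notin> ?J"
        using K unfolding carrier_alg_A by blast
      define c where "c = Poly_Mapping.lookup p 0"
      have p1: "p - mpoly_const c \<in> adm_poly q n e 1"
        unfolding c_def using p(1) by (rule adm_poly_0_split)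
      have c: "c \<noteq> 0"
        using p p1 by (auto simp: mpoly_const_def)
      have "- (p - mpoly_const c) \<in> adm_poly q n e 1"
        using p1 by (rule adm_poly_uminus)
      then have "residue_class q n (- (p - mpoly_const c)) \<in> K"
        using K by blast
      then have "residue_class q n p \<oplus>\<^bsub>?A\<^esub> residue_class q n (- (p - mpoly_const c)) \<in> K"
        using p by (intro K.a_closed)
      then have "residue_class q n (mpoly_const c) \<in> K"
        using adm_polyD[OF p(1)] adm_polyD[OF adm_poly_uminus[OF p1]]
        by (simp add: residue_class_add)
      then have "residue_class q n (mpoly_const c) \<otimes>\<^bsub>?A\<^esub> residue_class q n (mpoly_const (inverse c)) \<in> K"
        by (rule K.I_r_closed) (unfold carrier_alg_A, intro imageI mpoly_const_adm_poly)
      also have "residue_class q n (mpoly_const c) \<otimes>\<^bsub>?A\<^esub> residue_class q n (mpoly_const (inverse c)) =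
          residue_class q n (mpoly_const c * mpoly_const (inverse c))"
        using residue_class_mult[OF mpoly_const_adm_poly[THEN adm_polyD] mpoly_const_adm_poly[THEN adm_polyD]]
        by simp
      also have "mpoly_const c * mpoly_const (inverse c) = 1"
        unfolding mpoly_const_def mult_single using c by simp
      finally show ?thesis
        using K.one_imp_carrier by (simp add: residue_class_one)
    qed (use K in blast)
  qed (rule J.is_ideal)
  then show "jacobson_radical ?A \<subseteq> ?J"
    by (auto simp: jacobson_radical_def)
  show "?J \<subseteq> jacobson_radical ?A"
  proof
    fix x assume x: "x \<in> ?J"
    then obtain p where p: "p \<in> adm_poly q n e 1" "x = residue_class q n p"
      by blast
    define k where "k = Suc (n * (q - 1))"
    have pk: "p ^ k \<in> adm_poly q n e k" and xk: "x [^]\<^bsub>?A\<^esub> k = residue_class q n (p ^ k)"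
      using residue_class_power[OF p(1)] p(2) by auto
    have "p ^ k \<in> power_ideal q n"
      using pk by (rule adm_poly_power_ideal) (simp add: k_def)
    then have "x [^]\<^bsub>?A\<^esub> k = \<zero>\<^bsub>?A\<^esub>"
      unfolding xk using residue_class_eq_zero_iff[OF adm_polyD[OF pk]] by simp
    moreover have "\<zero>\<^bsub>?A\<^esub> \<in> M" if "maximalideal M ?A" for M
      using that by (meson additive_subgroup.zero_closed ideal.axioms(1) maximalideal.axioms(1))
    ultimately have "x \<in> M" if "maximalideal M ?A" for M
      using that primeideal.power_mem_imp_mem[OF A.maximalideal_prime[OF that] J.Icarr[OF x], of k]
      by metis
    then show "x \<in> jacobson_radical ?A"
      using J.Icarr[OF x] by (simp add: jacobson_radical_def)
  qed
qed

section \<open>Powers of the radical and the Loewy length\<close>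

lemma ideal_ideals_set_power:
  fixes R (structure)
  assumes "cring R" "ideal I R"
  shows "ideal (I [^]\<^bsub>ideals_set R\<^esub> (k::nat)) R"
proof -
  interpret cring R by fact
  interpret M: comm_monoid "ideals_set R" by (rule ideals_set_is_comm_monoid)
  show ?thesis
    using M.nat_pow_closed[of I k] assms by (simp add: ideals_set_def)
qed

text \<open>The radical is spanned by nonzero admissible monomials, each of degree at least
  \<open>m\<close>, and degrees add up under multiplication.\<close>

lemma ideal_adm_poly_power_subset:
  assumes "\<And>i. admissible q n e i \<Longrightarrow> i \<noteq> 0 \<Longrightarrow> m \<le> total_degree n i"
  shows "(residue_class q n ` adm_poly q n e 1) [^]\<^bsub>ideals_set (alg_A q n e :: ((nat \<Rightarrow>\<^sub>0 nat) \<Rightarrow>\<^sub>0 'a::field) set ring)\<^esub> l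
    \<subseteq> residue_class q n ` adm_poly q n e (l * m)"
    (is "?J [^]\<^bsub>ideals_set ?A\<^esub> _ \<subseteq> _")
proof (induction l)
  case 0
  then show ?case
    by (simp add: nat_pow_def ideals_set_def carrier_alg_A)
next
  case (Suc l)
  have sub: "(adm_poly q n e 1 :: ((nat \<Rightarrow>\<^sub>0 nat) \<Rightarrow>\<^sub>0 'a) set) \<subseteq> adm_poly q n e m"
    unfolding adm_poly_def by (rule subsetI, erule supported_mono) (use assms in fastforce)
  show ?case
  proof
    fix x
    assume "x \<in> ?J [^]\<^bsub>ideals_set ?A\<^esub> Suc l"
    then have "x \<in> ideal_prod ?A
        (?J [^]\<^bsub>ideals_set ?A\<^esub> l)
        ?J"
      by (simp add: nat_pow_def ideals_set_def)
    then show "x \<in> residue_class q n ` adm_poly q n e (Suc l * m)"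
    proof (induction rule: ideal_prod.induct)
      case (prod x y)
      have "x \<in> residue_class q n ` adm_poly q n e (l * m)"
        using Suc prod(1) by (rule subsetD)
      moreover have "y \<in> residue_class q n ` adm_poly q n e m"
        using image_mono[OF sub] prod(2) by (rule subsetD)
      ultimately show ?case
        using residue_class_image_mult[of x q n e "l * m" y m] by (simp add: add.commute)
    next
      case (sum x y)
      then show ?case
        by (simp add: residue_class_image_add)
    qed
  qed
qed

text \<open>Supplies the witnesses that a power of the radical is nonzero. Admissibility of the sum
  is part of the induction because multiplying residue classes needs the partial product to lie in
  the polynomial ring.\<close>

lemma monomial_mem_ideal_power:
  assumes "\<forall>v\<in>set vs. admissible q n e v \<and> v \<noteq> 0"
  shows "admissible q n e (sum_list vs) \<and> residue_class q n (mpoly_monomial (sum_list vs))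
    \<in> (residue_class q n ` adm_poly q n e 1) [^]\<^bsub>ideals_set (alg_A q n e :: ((nat \<Rightarrow>\<^sub>0 nat) \<Rightarrow>\<^sub>0 'a::field) set ring)\<^esub> length vs"
    (is "_ \<and> _ \<in> ?J [^]\<^bsub>ideals_set ?A\<^esub> _")
  using assms
proof (induction vs)
  case Nil
  show ?case
    by (auto simp: nat_pow_def ideals_set_def carrier_alg_A mpoly_monomial_def adm_poly_def
        intro!: imageI supported_one)
next
  case (Cons v vs)
  have v: "(mpoly_monomial v :: (nat \<Rightarrow>\<^sub>0 nat) \<Rightarrow>\<^sub>0 'a) \<in> adm_poly q n e 1"
  proof -
    have "admissible q n e v" "total_degree n v \<noteq> 0"
      using Cons.prems total_degree_eq_0_iff[of n v] by (simp_all add: admissible_def)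
    then show ?thesis
      unfolding mpoly_monomial_def adm_poly_def by (intro supported_single) simp
  qed
  have vs: "(mpoly_monomial (sum_list vs) :: (nat \<Rightarrow>\<^sub>0 nat) \<Rightarrow>\<^sub>0 'a) \<in> carrier (mpoly_ring n)"
    using Cons by (auto simp: mpoly_monomial_def carrier_mpoly_ring admissible_def intro!: supported_single)
  have "residue_class q n (mpoly_monomial (sum_list vs)) \<otimes>\<^bsub>?A\<^esub> residue_class q n (mpoly_monomial v)
    \<in> ?J [^]\<^bsub>ideals_set ?A\<^esub> Suc (length vs)"
    using Cons v unfolding nat_pow_def
    by (simp add: ideals_set_def del: alg_A_simps) (auto intro!: ideal_prod.prod simp del: alg_A_simps)
  then show ?case
    using Cons adm_polyD[OF v] vs
    by (simp add: residue_class_mult mpoly_monomial_def mult_single add.commute admissible_add)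
qed

text \<open>The interface to the combinatorics: \<open>m\<close> bounds degrees from below, so the
  power \<open>Suc t\<close> lies in degrees beyond every reduced exponent, while \<open>vs\<close>
  keeps all smaller powers nonzero.\<close>

lemma loewy_length_alg_A:
  assumes "q > 0"
    and "\<And>i. admissible q n e i \<Longrightarrow> i \<noteq> 0 \<Longrightarrow> m \<le> total_degree n i"
    and "n * (q - 1) < Suc t * m"
    and "length vs = t" "\<forall>v\<in>set vs. admissible q n e v \<and> v \<noteq> 0" "reduced q n (sum_list vs)"
  shows "loewy_length (alg_A q n e :: ((nat \<Rightarrow>\<^sub>0 nat) \<Rightarrow>\<^sub>0 'a::field) set ring) = Suc t"
  unfolding loewy_length_def jacobson_radical_alg_A[OF assms(1)]
proof (rule Least_equality)
  let ?A = "alg_A q n e :: ((nat \<Rightarrow>\<^sub>0 nat) \<Rightarrow>\<^sub>0 'a) set ring"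
  let ?J = "residue_class q n ` adm_poly q n e 1 :: ((nat \<Rightarrow>\<^sub>0 nat) \<Rightarrow>\<^sub>0 'a) set set"
  have "\<zero>\<^bsub>?A\<^esub> \<in> ?J [^]\<^bsub>ideals_set ?A\<^esub> Suc t"
    using ideal_ideals_set_power[OF cring_alg_A ideal_adm_poly]
    by (meson additive_subgroup.zero_closed ideal.axioms(1))
  moreover have "?J [^]\<^bsub>ideals_set ?A\<^esub> Suc t \<subseteq> residue_class q n ` adm_poly q n e (Suc t * m)"
    by (rule ideal_adm_poly_power_subset) (rule assms)
  moreover have "residue_class q n p = \<zero>\<^bsub>?A\<^esub>" if "p \<in> adm_poly q n e (Suc t * m)" for p
    using that adm_poly_power_ideal[OF that assms(3)] adm_polyD[OF that]
    by (simp add: residue_class_eq_zero_iff)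
  ultimately show "?J [^]\<^bsub>ideals_set ?A\<^esub> Suc t = {\<zero>\<^bsub>?A\<^esub>}"
    by blast
next
  let ?A = "alg_A q n e :: ((nat \<Rightarrow>\<^sub>0 nat) \<Rightarrow>\<^sub>0 'a) set ring"
  let ?J = "residue_class q n ` adm_poly q n e 1 :: ((nat \<Rightarrow>\<^sub>0 nat) \<Rightarrow>\<^sub>0 'a) set set"
  fix l :: nat assume l: "?J [^]\<^bsub>ideals_set ?A\<^esub> l = {\<zero>\<^bsub>?A\<^esub>}"
  show "Suc t \<le> l"
  proof (rule ccontr)
    assume "\<not> Suc t \<le> l"
    then have len: "length (take l vs) = l"
      using assms(4) by simp
    \<comment> \<open>A vanishing power of order \<open>l\<close> at most \<open>t\<close> would
      kill the product of the first \<open>l\<close> monomials, although their sum is a summand of a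
      reduced exponent.\<close>
    define i where "i = sum_list (take l vs)"
    have "admissible q n e i \<and> residue_class q n (mpoly_monomial i) \<in> ?J [^]\<^bsub>ideals_set ?A\<^esub> length (take l vs)"
      unfolding i_def using assms(5) by (intro monomial_mem_ideal_power) (auto dest: in_set_takeD)
    then have i: "admissible q n e i" "residue_class q n (mpoly_monomial i) = \<zero>\<^bsub>?A\<^esub>"
      unfolding len l by auto
    then have "(mpoly_monomial i :: (nat \<Rightarrow>\<^sub>0 nat) \<Rightarrow>\<^sub>0 'a) \<in> carrier (mpoly_ring n)"
      by (auto simp: mpoly_monomial_def carrier_mpoly_ring admissible_def intro!: supported_single)
    then have "(mpoly_monomial i :: (nat \<Rightarrow>\<^sub>0 nat) \<Rightarrow>\<^sub>0 'a) \<in> power_ideal q n"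
      using i by (simp add: residue_class_eq_zero_iff)
    then have "\<not> reduced q n i"
      by (simp add: power_ideal_eq mpoly_monomial_def supported_def)
    moreover have "sum_list vs = i + sum_list (drop l vs)"
      unfolding i_def by (metis append_take_drop_id sum_list.append)
    ultimately show False
      using assms(6) reduced_addD by metis
  qed
qed

section \<open>Distributing sums of powers over coordinates\<close>

lemma sum_list_concat_map: "sum_list (concat xss) = (\<Sum>xs\<leftarrow>xss. sum_list xs)"
  by (induction xss) auto

section \<open>The minimal length as a degree bound\<close>

lemma min_power_sum_le:
  assumes "js \<noteq> []" "e dvd (\<Sum>j\<leftarrow>js. q ^ j)"
  shows "min_power_sum q e \<le> length js"
  unfolding min_power_sum_def using assms by (intro Least_le) auto

lemma min_power_sum_attained:
  assumes "e > 0"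
  obtains js where "length js = min_power_sum q e" "js \<noteq> []" "e dvd (\<Sum>j\<leftarrow>js. q ^ j)"
proof -
  have "\<exists>t>0. \<exists>js::nat list. length js = t \<and> e dvd (\<Sum>j\<leftarrow>js. q ^ j)"
    \<comment> \<open>\<open>e\<close> copies of \<open>q ^ 0\<close> sum to \<open>e\<close>, so
      the set under \<open>LEAST\<close> is nonempty.\<close>
    using assms by (intro exI[of _ e] conjI exI[of _ "replicate e 0"]) (auto simp: sum_list_replicate)
  then have "min_power_sum q e > 0 \<and>
      (\<exists>js::nat list. length js = min_power_sum q e \<and> e dvd (\<Sum>j\<leftarrow>js. q ^ j))"
    unfolding min_power_sum_def by (rule LeastI_ex)
  then show ?thesis
    using that by force
qed

lemma min_power_sum_le_total_degree:
  assumes "admissible q n e i" "i \<noteq> 0"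
  shows "min_power_sum q e \<le> total_degree n i"
proof -
  \<comment> \<open>Coordinate \<open>j\<close> has weight \<open>q ^ (j - 1)\<close>, so the
    exponent \<open>j - 1\<close> is listed as often as the entry at \<open>j\<close> says.\<close>
  define js where "js = concat (map (\<lambda>j. replicate (Poly_Mapping.lookup i j) (j - 1)) [1..<Suc n])"
  have "length js = (\<Sum>j\<leftarrow>[1..<Suc n]. Poly_Mapping.lookup i j)"
    by (simp add: js_def length_concat o_def del: upt_Suc)
  also have "\<dots> = total_degree n i"
    unfolding total_degree_def interv_sum_list_conv_sum_set_nat by (intro sum.cong) auto
  finally have len: "length js = total_degree n i" .
  have "(\<Sum>j\<leftarrow>js. q ^ j) = (\<Sum>j\<leftarrow>[1..<Suc n]. q ^ (j - 1) * Poly_Mapping.lookup i j)"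
    by (simp add: js_def map_concat sum_list_concat_map o_def sum_list_replicate mult.commute del: upt_Suc)
  also have "\<dots> = (\<Sum>j=1..n. q ^ (j - 1) * Poly_Mapping.lookup i j)"
    unfolding interv_sum_list_conv_sum_set_nat by (intro sum.cong) auto
  finally have "e dvd (\<Sum>j\<leftarrow>js. q ^ j)"
    using assms by (simp add: admissible_def)
  moreover have "js \<noteq> []"
    using len assms total_degree_eq_0_iff[of n i] by (auto simp: admissible_def)
  ultimately show ?thesis
    using min_power_sum_le len by metis
qed

section \<open>Counting exponents modulo d\<close>

definition residue_count :: "nat \<Rightarrow> nat \<Rightarrow> nat list \<Rightarrow> nat" where
  "residue_count d c js = (\<Sum>j\<leftarrow>js. of_bool (j mod d = c))"

lemma residue_count_simps [simp]:
  "residue_count d c [] = 0"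
  "residue_count d c (j # js) = of_bool (j mod d = c) + residue_count d c js"
  "residue_count d c (js @ js') = residue_count d c js + residue_count d c js'"
  by (simp_all add: residue_count_def)

lemma sum_of_bool_mod: "d > 0 \<Longrightarrow> (\<Sum>c<d. f c * of_bool (j mod d = c)) = f (j mod d)"
  for d :: nat and f :: "nat \<Rightarrow> nat"
  by (simp add: of_bool_def if_distrib sum.delta cong: if_cong)

lemma sum_residue_count: "d > 0 \<Longrightarrow> (\<Sum>c<d. residue_count d c js) = length js"
  by (induction js) (use sum_of_bool_mod[where f = "\<lambda>_. 1"] in \<open>auto simp: sum.distrib\<close>)

lemma cong_power_mod_exponent:
  fixes q e :: nat
  assumes "[q ^ d = 1] (mod e)"
  shows "[q ^ (j mod d) = q ^ j] (mod e)"
proof -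
  have "q ^ j = (q ^ d) ^ (j div d) * q ^ (j mod d)"
    by (simp flip: power_mult power_add)
  moreover have "[(q ^ d) ^ (j div d) * q ^ (j mod d) = 1 ^ (j div d) * q ^ (j mod d)] (mod e)"
    using assms by (intro cong_mult cong_pow) auto
  ultimately show ?thesis
    by (simp add: cong_sym)
qed

text \<open>Divisibility by \<open>e\<close> therefore depends only on how often each residue
  occurs, which leaves the choice of coordinates within a residue class free.\<close>

lemma cong_sum_residue_count:
  assumes "d > 0" "[q ^ d = 1] (mod e)"
  shows "[(\<Sum>c<d. q ^ c * residue_count d c js) = (\<Sum>j\<leftarrow>js. q ^ j)] (mod e)"
proof (induction js)
  case (Cons j js)
  have "(\<Sum>c<d. q ^ c * residue_count d c (j # js)) =
      q ^ (j mod d) + (\<Sum>c<d. q ^ c * residue_count d c js)"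
    using sum_of_bool_mod[OF assms(1), of "\<lambda>c. q ^ c" j] by (simp add: ring_distribs sum.distrib)
  then show ?case
    using cong_add[OF cong_power_mod_exponent[OF assms(2)] Cons] by simp
qed auto

text \<open>Greedy filling: the last place takes as much as it can hold and the rest goes to the
  earlier ones.\<close>

lemma exists_bounded_summands:
  fixes cap :: "nat \<Rightarrow> nat"
  assumes "x \<le> (\<Sum>b<k. cap b)"
  shows "\<exists>y. (\<forall>b<k. y b \<le> cap b) \<and> (\<Sum>b<k. y b) = x"
  using assms
proof (induction k arbitrary: x)
  case (Suc k)
  define z where "z = min x (cap k)"
  have "x - z \<le> (\<Sum>b<k. cap b)"
    using Suc.prems by (auto simp: z_def)
  then obtain y where y: "\<forall>b<k. y b \<le> cap b" "(\<Sum>b<k. y b) = x - z"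
    using Suc.IH by blast
  show ?case
    by (rule exI[of _ "y(k := z)"]) (use y in \<open>auto simp: z_def less_Suc_eq\<close>)
qed auto

lemma exists_exponent: "\<exists>v. in_vars n v \<and> (\<forall>j\<in>{1..n}. Poly_Mapping.lookup v j = f j)"
proof (intro exI conjI)
  let ?v = "\<Sum>j\<in>{1..n}. Poly_Mapping.single j (f j)"
  have l: "Poly_Mapping.lookup ?v j = (if j \<in> {1..n} then f j else 0)" for j
    by (simp add: lookup_sum lookup_single when_def sum.delta)
  show "in_vars n ?v"
    unfolding in_vars_def
  proof
    fix j assume "j \<in> Poly_Mapping.keys ?v"
    then show "j \<in> {1..n}"
      unfolding in_keys_iff l by (auto split: if_splits)
  qed
  show "\<forall>j\<in>{1..n}. Poly_Mapping.lookup ?v j = f j"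
    unfolding l by simp
qed

text \<open>Coordinate \<open>Suc (b * d + c)\<close> is place \<open>c\<close> of block
  \<open>b\<close>. Its weight has exponent \<open>b * d + c\<close>, so all places \<open>c\<close>
  belong to the same residue.\<close>

lemma sum_blocks:
  fixes g :: "nat \<Rightarrow> nat"
  shows "(\<Sum>j=1..d * k. g j) = (\<Sum>c<d. \<Sum>b<k. g (Suc (b * d + c)))"
proof -
  have "(\<Sum>j=1..d * k. g j) = (\<Sum>j<k * d. g (Suc j))"
    by (rule sum.reindex_bij_witness[of _ Suc "\<lambda>j. j - 1"]) (auto simp: mult.commute)
  also have "\<dots> = (\<Sum>b<k. \<Sum>j\<in>{b * d..<b * d + d}. g (Suc j))"
    by (rule sum.nat_group[symmetric])
  also have "\<dots> = (\<Sum>b<k. \<Sum>c<d. g (Suc (b * d + c)))"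
  proof (rule sum.cong)
    fix b
    show "(\<Sum>j\<in>{b * d..<b * d + d}. g (Suc j)) = (\<Sum>c<d. g (Suc (b * d + c)))"
      by (rule sum.reindex_bij_witness[of _ "\<lambda>c. b * d + c" "\<lambda>j. j - b * d"]) auto
  qed simp
  also have "\<dots> = (\<Sum>c<d. \<Sum>b<k. g (Suc (b * d + c)))"
    by (rule sum.swap)
  finally show ?thesis .
qed

text \<open>A packing of relations: \<open>b\<close> is the capacity common to all residues modulo
  \<open>d\<close>, later \<open>k * (q - 1)\<close> for k blocks.\<close>

definition power_sum_family :: "nat \<Rightarrow> nat \<Rightarrow> nat \<Rightarrow> nat \<Rightarrow> nat list list \<Rightarrow> bool" where
  "power_sum_family q e d b jss \<longleftrightarrow>
     (\<forall>js\<in>set jss. js \<noteq> [] \<and> e dvd (\<Sum>j\<leftarrow>js. q ^ j)) \<and>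
     (\<forall>c<d. residue_count d c (concat jss) \<le> b)"

lemma power_sum_family_ConsD: "power_sum_family q e d b (js # jss) \<Longrightarrow> power_sum_family q e d b jss"
  by (auto simp: power_sum_family_def intro: add_leD2)

lemma block_index:
  fixes b c d k :: nat
  assumes "b < k" "c < d"
  shows "Suc (b * d + c) \<in> {1..d * k}" "(b * d + c) div d = b" "(b * d + c) mod d = c"
proof -
  have "b * d + c < Suc b * d"
    using assms by simp
  also have "\<dots> \<le> k * d"
    using assms by (intro mult_le_mono1) simp
  finally show "Suc (b * d + c) \<in> {1..d * k}"
    by (simp add: mult.commute)
  show "(b * d + c) div d = b" "(b * d + c) mod d = c"
    using assms by auto
qed

(* A coordinate j of an exponent only enters the congruence through (j - 1) mod d, so the
   count of each residue may be spread over its k coordinates, each of capacity q - 1. *)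
lemma exists_admissible_list:
  assumes "d > 0" "q > 0" "[q ^ d = 1] (mod e)"
    and "power_sum_family q e d (k * (q - 1)) jss"
  shows "\<exists>vs. length vs = length jss \<and> (\<forall>v\<in>set vs. admissible q (d * k) e v \<and> v \<noteq> 0) \<and>
    reduced q (d * k) (sum_list vs) \<and>
    (\<forall>c<d. (\<Sum>b<k. Poly_Mapping.lookup (sum_list vs) (Suc (b * d + c))) = residue_count d c (concat jss))"
  using assms(4)
proof (induction jss)
  case Nil
  then show ?case
    using assms(2) by (auto simp: reduced_def)
next
  case (Cons js jss)
  then obtain vs where vs: "length vs = length jss"
    "\<forall>v\<in>set vs. admissible q (d * k) e v \<and> v \<noteq> 0" "reduced q (d * k) (sum_list vs)"
    "\<And>c. c < d \<Longrightarrow> (\<Sum>b<k. Poly_Mapping.lookup (sum_list vs) (Suc (b * d + c))) =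
       residue_count d c (concat jss)"
    using power_sum_family_ConsD[OF Cons.prems] by blast
  define u where "u = Poly_Mapping.lookup (sum_list vs)"
  have u: "u (Suc (b * d + c)) < q" if "b < k" "c < d" for b c
    using vs(3) block_index[OF that] by (auto simp: reduced_def u_def)
  \<comment> \<open>The free room in class \<open>c\<close> is \<open>k * (q - 1)\<close> minus its
    uses so far, which the last conjunct of the induction claim records, so the uses in
    \<open>js\<close> still fit.\<close>
  have "\<exists>y. (\<forall>b<k. y b \<le> q - 1 - u (Suc (b * d + c))) \<and> (\<Sum>b<k. y b) = residue_count d c js"
    if c: "c < d" for c
  proof (rule exists_bounded_summands)
    have "(\<Sum>b<k. q - 1 - u (Suc (b * d + c))) + (\<Sum>b<k. u (Suc (b * d + c))) = (\<Sum>b<k. q - 1)"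
      unfolding sum.distrib[symmetric] using u c by (intro sum.cong) fastforce+
    moreover have "residue_count d c js + residue_count d c (concat jss) \<le> k * (q - 1)"
      using Cons.prems c by (auto simp: power_sum_family_def)
    ultimately show "residue_count d c js \<le> (\<Sum>b<k. q - 1 - u (Suc (b * d + c)))"
      using vs(4)[OF c] by (simp add: u_def)
  qed
  then obtain y where y: "\<And>b c. b < k \<Longrightarrow> c < d \<Longrightarrow> y c b \<le> q - 1 - u (Suc (b * d + c))"
    "\<And>c. c < d \<Longrightarrow> (\<Sum>b<k. y c b) = residue_count d c js"
    by metis
  obtain v where v: "in_vars (d * k) v"
    "\<forall>j\<in>{1..d * k}. Poly_Mapping.lookup v j = y ((j - 1) mod d) ((j - 1) div d)"
    using exists_exponent[of "d * k" "\<lambda>j. y ((j - 1) mod d) ((j - 1) div d)"] by blast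
  have vy: "Poly_Mapping.lookup v (Suc (b * d + c)) = y c b" if "b < k" "c < d" for b c
    using bspec[OF v(2) block_index(1)[OF that]] block_index(2,3)[OF that] by simp
  have "(\<Sum>j=1..d * k. q ^ (j - 1) * Poly_Mapping.lookup v j) =
      (\<Sum>c<d. \<Sum>b<k. q ^ (b * d + c) * y c b)"
    unfolding sum_blocks by (intro sum.cong) (auto simp: vy)
  also have "[\<dots> = (\<Sum>c<d. \<Sum>b<k. q ^ c * y c b)] (mod e)"
  proof (intro cong_sum cong_mult cong_refl)
    fix c b assume "c \<in> {..<d}"
    then show "[q ^ (b * d + c) = q ^ c] (mod e)"
      using cong_power_mod_exponent[OF assms(3), of "b * d + c"] by (simp add: cong_sym)
  qed
  also have "(\<Sum>c<d. \<Sum>b<k. q ^ c * y c b) = (\<Sum>c<d. q ^ c * residue_count d c js)"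
    by (simp add: y flip: sum_distrib_left)
  also have "[\<dots> = (\<Sum>j\<leftarrow>js. q ^ j)] (mod e)"
    by (rule cong_sum_residue_count[OF assms(1,3)])
  finally have "e dvd (\<Sum>j=1..d * k. q ^ (j - 1) * Poly_Mapping.lookup v j)"
    using Cons.prems cong_dvd_iff by (auto simp: power_sum_family_def)
  then have adm: "admissible q (d * k) e v"
    using v(1) by (simp add: admissible_def)
  have sum_v: "(\<Sum>b<k. Poly_Mapping.lookup v (Suc (b * d + c))) = residue_count d c js" if "c < d" for c
    using that by (simp add: vy y)
  \<comment> \<open>The counts of \<open>js\<close> over all residues add up to its positive
    length.\<close>
  have "v \<noteq> 0"
  proof
    assume "v = 0"
    then have "residue_count d c js = 0" if "c < d" for c
      using sum_v[OF that] by simp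
    then show False
      using sum_residue_count[OF assms(1), of js] Cons.prems by (simp add: power_sum_family_def)
  qed
  moreover have "reduced q (d * k) (v + sum_list vs)"
    unfolding reduced_def
  proof
    fix j assume j: "j \<in> {1..d * k}"
    define b c where "b = (j - 1) div d" and "c = (j - 1) mod d"
    have bc: "b < k" "c < d" "j = Suc (b * d + c)"
      using j assms(1) by (auto simp: b_def c_def less_mult_imp_div_less mult.commute)
    then show "Poly_Mapping.lookup (v + sum_list vs) j < q"
      using vy[OF bc(1,2)] y(1)[OF bc(1,2)] u[OF bc(1,2)] by (simp add: lookup_add u_def)
  qed
  ultimately show ?case
    using vs adm sum_v
    by (intro exI[of _ "v # vs"]) (auto simp: lookup_add sum.distrib)
qed

lemma loewy_length_alg_A_family:
  assumes "q > 0" "e > 0" "d > 0" "[q ^ d = 1] (mod e)"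
    and "power_sum_family q e d (k * (q - 1)) jss"
    and "length jss = d * k * (q - 1) div min_power_sum q e"
  shows "loewy_length (alg_A q (d * k) e :: ((nat \<Rightarrow>\<^sub>0 nat) \<Rightarrow>\<^sub>0 'a::field) set ring) =
    Suc (d * k * (q - 1) div min_power_sum q e)"
proof -
  obtain vs where vs: "length vs = length jss"
    "\<forall>v\<in>set vs. admissible q (d * k) e v \<and> v \<noteq> 0" "reduced q (d * k) (sum_list vs)"
    using exists_admissible_list[OF assms(3,1,4,5)] by blast
  have "min_power_sum q e > 0"
    using min_power_sum_attained[OF assms(2)] by (metis length_greater_0_conv)
  then have "d * k * (q - 1) < Suc (d * k * (q - 1) div min_power_sum q e) * min_power_sum q e"
    by (metis dividend_less_div_times add.commute mult_Suc)
  then show ?thesis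
    using vs assms(6) by (intro loewy_length_alg_A[OF assms(1) min_power_sum_le_total_degree]) auto
qed

section \<open>Optimal families of sums of powers\<close>

lemma residue_count_concat: "residue_count d c (concat jss) = (\<Sum>js\<leftarrow>jss. residue_count d c js)"
  by (induction jss) auto

lemma power_sum_family_append:
  "power_sum_family q e d a jss \<Longrightarrow> power_sum_family q e d b jss' \<Longrightarrow>
     power_sum_family q e d (a + b) (jss @ jss')"
  by (auto simp: power_sum_family_def intro: add_mono)

lemma power_sum_family_repeat:
  "power_sum_family q e d a jss \<Longrightarrow> power_sum_family q e d (r * a) (concat (replicate r jss))"
proof (induction r)
  case (Suc r)
  then show ?case
    using power_sum_family_append[of q e d a jss "r * a"] by simp
qed (simp add: power_sum_family_def)

lemma length_concat_replicate: "length (concat (replicate r xs)) = r * length xs"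
  by (induction r) auto

lemma residue_count_upt: "c < d \<Longrightarrow> residue_count d c [0..<d] = 1"
proof -
  assume c: "c < d"
  have "residue_count d c [0..<d] = (\<Sum>j<d. of_bool (j mod d = c))"
    by (simp add: residue_count_def interv_sum_list_conv_sum_set_nat atLeast0LessThan)
  also have "\<dots> = (\<Sum>j<d. if j = c then 1 else 0)"
    by (intro sum.cong) auto
  finally show ?thesis
    using c by simp
qed

lemma power_sum_family_ones:
  assumes "d > 0" "e dvd (\<Sum>c<d. q ^ c)"
  shows "power_sum_family q e d 1 [[0..<d]]"
  using assms
  by (auto simp: power_sum_family_def residue_count_upt interv_sum_list_conv_sum_set_nat atLeast0LessThan)

lemma sum_shifts_mod:
  fixes c d j :: nat
  assumes "c < d"
  shows "(\<Sum>s<d. of_bool ((s + j) mod d = c)) = (1::nat)"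
proof -
  have "inj_on (\<lambda>s. (s + j) mod d) {..<d}"
  proof (rule inj_onI)
    fix s t assume "s \<in> {..<d}" "t \<in> {..<d}" "(s + j) mod d = (t + j) mod d"
    moreover from this have "[s = t] (mod d)"
      by (simp flip: cong_def add: cong_add_rcancel_nat)
    ultimately show "s = t"
      by (simp add: cong_def)
  qed
  moreover have "(\<lambda>s. (s + j) mod d) ` {..<d} \<subseteq> {..<d}"
    using assms by auto
  ultimately have "bij_betw (\<lambda>s. (s + j) mod d) {..<d} {..<d}"
    by (simp add: bij_betw_def endo_inj_surj)
  then have "(\<Sum>s<d. of_bool ((s + j) mod d = c)) = (\<Sum>s<d. of_bool (s = c) :: nat)"
    by (rule sum.reindex_bij_betw)
  then show ?thesis
    using assms by (simp add: of_bool_def)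
qed

text \<open>A shift by \<open>s\<close> multiplies the sum by \<open>q ^ s\<close>, and as
  \<open>s\<close> varies each entry visits every residue exactly once.\<close>

lemma power_sum_family_shifts:
  assumes "d > 0" "js \<noteq> []" "e dvd (\<Sum>j\<leftarrow>js. q ^ j)"
  shows "power_sum_family q e d (length js) (map (\<lambda>s. map ((+) s) js) [0..<d])"
proof -
  have "(\<Sum>j\<leftarrow>js. q ^ (s + j)) = q ^ s * (\<Sum>j\<leftarrow>js. q ^ j)" for s
    by (induction js) (auto simp: power_add ring_distribs)
  moreover have "(\<Sum>s<d. residue_count d c (map ((+) s) js)) = length js" if "c < d" for c
    using sum_shifts_mod[OF that] by (induction js) (auto simp: sum.distrib)
  then have "residue_count d c (concat (map (\<lambda>s. map ((+) s) js) [0..<d])) = length js" if "c < d" for c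
    using that by (simp add: residue_count_concat o_def interv_sum_list_conv_sum_set_nat atLeast0LessThan)
  ultimately show ?thesis
    using assms by (simp add: power_sum_family_def o_def)
qed

section \<open>Bounds for the minimal length\<close>

lemma min_power_sum_pos: "e > 0 \<Longrightarrow> min_power_sum q e > 0"
  using min_power_sum_attained by (metis length_greater_0_conv)

lemma length_eq_2E:
  assumes "length xs = 2"
  obtains x y where "xs = [x, y]"
  using assms by (auto simp: eval_nat_numeral length_Suc_conv)

lemma length_eq_3E:
  assumes "length xs = 3"
  obtains x y z where "xs = [x, y, z]"
  using assms by (auto simp: eval_nat_numeral length_Suc_conv)

lemma min_power_sum_cong_1:
  assumes "e > 0" "[q = 1] (mod e)"
  shows "min_power_sum q e = e"
proof -
  have sum: "[(\<Sum>j\<leftarrow>js. q ^ j) = length js] (mod e)" for js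
    by (induction js) (use cong_add[OF cong_pow[OF assms(2)]] in auto)
  obtain js where js: "length js = min_power_sum q e" "js \<noteq> []" "e dvd (\<Sum>j\<leftarrow>js. q ^ j)"
    using min_power_sum_attained[OF assms(1)] .
  then have "e dvd length js"
    using cong_dvd_iff[OF sum] by blast
  then have "e \<le> min_power_sum q e"
    using js by (metis dvd_imp_le length_greater_0_conv)
  moreover have "e dvd (\<Sum>j\<leftarrow>replicate e 0. q ^ j)"
    by (simp add: sum_list_replicate)
  then have "min_power_sum q e \<le> e"
    using min_power_sum_le[of "replicate e 0" e q] assms by simp
  ultimately show ?thesis
    by simp
qed

lemma coprime_of_power_cong_1: "[q ^ d = 1] (mod e) \<Longrightarrow> d > 0 \<Longrightarrow> coprime q e"
  for q e :: nat
  using cong_imp_coprime[of 1 "q ^ d" e] by (simp add: cong_sym)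

text \<open>Disposes of the moduli 1 and 2, for which a sign cannot be detected: 1 = -1 modulo
  \<open>e\<close> forces \<open>q\<close> to be 1 as well.\<close>

lemma cong_1_of_dvd_2:
  fixes q e :: nat
  assumes "[q ^ d = 1] (mod e)" "d > 0" "e dvd 2"
  shows "[q = 1] (mod e)"
proof -
  have "e = 1 \<or> e = 2"
    using assms(3) dvd_imp_le[of e 2] by (cases e) (auto simp: le_Suc_eq numeral_2_eq_2)
  moreover have "odd q" if "e = 2"
    using coprime_of_power_cong_1[OF assms(1,2)] that by simp
  ultimately show ?thesis
    by (auto simp: cong_def odd_iff_mod_2_eq_one)
qed

text \<open>A power of \<open>q\<close> is a unit modulo \<open>e\<close>, hence divisible by
  \<open>e\<close> only if \<open>e = 1\<close>, and then \<open>q\<close> is congruent to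
  1.\<close>

lemma min_power_sum_neq_1:
  assumes "e > 0" "[q ^ d = 1] (mod e)" "d > 0" "\<not> [q = 1] (mod e)"
  shows "min_power_sum q e \<noteq> 1"
proof
  assume "min_power_sum q e = 1"
  then obtain js where js: "length js = 1" "e dvd (\<Sum>j\<leftarrow>js. q ^ j)"
    using min_power_sum_attained[OF assms(1), of q] by metis
  then obtain j where "js = [j]"
    by (auto simp: length_Suc_conv)
  then have "e dvd q ^ j"
    using js by simp
  moreover have "coprime (q ^ j) e"
    using coprime_of_power_cong_1[OF assms(2,3)] by simp
  ultimately have "e = 1"
    using coprime_common_divisor[of "q ^ j" e e] by simp
  then show False
    using assms by simp
qed

(* For odd d, q^a = -q^b modulo e would give 1 = q^(a*d) = -q^(b*d) = -1. *)
lemma min_power_sum_neq_2: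
  assumes "e > 0" "[q ^ d = 1] (mod e)" "odd d" "\<not> [q = 1] (mod e)"
  shows "min_power_sum q e \<noteq> 2"
proof
  assume "min_power_sum q e = 2"
  then obtain js where js: "length js = 2" "e dvd (\<Sum>j\<leftarrow>js. q ^ j)"
    using min_power_sum_attained[OF assms(1), of q] by metis
  then obtain a b where "int e dvd int q ^ a + int q ^ b"
    by (elim length_eq_2E) (auto simp flip: of_nat_power of_nat_add)
  then have "[int q ^ a = - (int q ^ b)] (mod int e)"
    by (simp add: cong_iff_dvd_diff)
  then have "[(int q ^ a) ^ d = (- (int q ^ b)) ^ d] (mod int e)"
    by (rule cong_pow)
  then have "int e dvd (int q ^ a) ^ d + (int q ^ b) ^ d"
    using \<open>odd d\<close> by (simp add: cong_iff_dvd_diff)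
  moreover have "[(int q ^ c) ^ d = 1] (mod int e)" for c
  proof -
    have "[int (q ^ d) = int 1] (mod int e)"
      using assms(2) by (simp only: cong_int_iff)
    then have "[(int q ^ d) ^ c = 1 ^ c] (mod int e)"
      by (intro cong_pow) simp
    then show ?thesis
      by (simp add: mult.commute flip: power_mult)
  qed
  then have "[(int q ^ a) ^ d + (int q ^ b) ^ d = 1 + 1] (mod int e)"
    by (intro cong_add)
  ultimately have "int e dvd 2"
    using cong_dvd_iff by fastforce
  then have "e dvd 2"
    using int_dvd_int_iff[of e 2] by simp
  then show False
    using cong_1_of_dvd_2 assms odd_pos by blast
qed


lemma min_power_sum_le_of_ones:
  assumes "d > 0" "e dvd (\<Sum>c<d. q ^ c)"
  shows "min_power_sum q e \<le> d"
  using min_power_sum_le[of "[0..<d]" e q] assms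
  by (simp add: interv_sum_list_conv_sum_set_nat atLeast0LessThan)

lemma power_cong_1_of_sum_dvd:
  fixes q e :: nat
  assumes "e dvd (\<Sum>c<d. q ^ c)" "q > 0"
  shows "[q ^ d = 1] (mod e)"
proof -
  have "int q ^ d - 1 = (int q - 1) * (\<Sum>c<d. int q ^ c)"
    by (rule power_diff_1_eq)
  moreover have "int e dvd int (\<Sum>c<d. q ^ c)"
    using assms(1) by (simp only: int_dvd_int_iff)
  ultimately have "int e dvd int q ^ d - 1"
    by simp
  then have "[int (q ^ d) = int 1] (mod int e)"
    by (simp add: cong_iff_dvd_diff)
  then show ?thesis
    by (simp only: cong_int_iff)
qed

section \<open>Families for order 1, full sums and order 4\<close>

lemma power_sum_family_div_1:
  assumes "e > 0" "[q = 1] (mod e)"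
  shows "\<exists>jss. power_sum_family q e 1 b jss \<and> length jss = b div min_power_sum q e"
proof -
  have "residue_count 1 0 (concat (replicate r (replicate s 0))) = r * s" for r s
    by (simp add: residue_count_def map_concat sum_list_concat_map o_def sum_list_replicate)
  then show ?thesis
    using assms
    \<comment> \<open>For d = 1 there is a single residue, and \<open>e\<close> copies of the
      exponent 0 form a shortest relation.\<close>
    by (intro exI[of _ "replicate (b div e) (replicate e 0)"])
      (auto simp: power_sum_family_def min_power_sum_cong_1 sum_list_replicate set_replicate_conv_if)
qed

lemma power_sum_family_of_ones:
  assumes "d > 0" "e dvd (\<Sum>c<d. q ^ c)" "min_power_sum q e = d"
  shows "\<exists>jss. power_sum_family q e d b jss \<and> length jss = d * b div min_power_sum q e"
  using power_sum_family_repeat[OF power_sum_family_ones[OF assms(1,2)], of b] assms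
  by (intro exI[of _ "concat (replicate b [[0..<d]])"]) (simp add: length_concat_replicate)

lemma power_sum_family_4:
  assumes "e > 0" "e dvd q ^ 2 + 1" "\<not> [q = 1] (mod e)" "[q ^ 4 = 1] (mod e)"
  shows "\<exists>jss. power_sum_family q e 4 b jss \<and> length jss = 4 * b div min_power_sum q e"
proof -
  have "min_power_sum q e \<le> 2"
    using min_power_sum_le[of "[0, 2]" e q] assms(2) by simp
  then have m: "min_power_sum q e = 2"
    using min_power_sum_neq_1[OF assms(1,4) _ assms(3)] min_power_sum_pos[OF assms(1), of q] by simp
  have eq: "q + q ^ 3 = q * (q ^ 2 + 1)"
    by (simp add: eval_nat_numeral)
  have "e dvd q + q ^ 3"
    using dvd_mult[OF assms(2), of q] by (simp only: eq)
  \<comment> \<open>The relation 1 + q^2 and its multiple by q split the four residues into two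
    pairs.\<close>
  then have "power_sum_family q e 4 1 [[0, 2], [1, 3]]"
    using assms(2) by (auto simp: power_sum_family_def)
  then show ?thesis
    using power_sum_family_repeat[of q e 4 1 "[[0, 2], [1, 3]]" b] m
    by (intro exI[of _ "concat (replicate b [[0, 2], [1, 3]])"]) (simp add: length_concat_replicate)
qed

section \<open>Families for order 5\<close>

lemma cong_dvd_sum_mod:
  fixes q e :: nat
  assumes "d > 0" "[q ^ d = 1] (mod e)" "\<And>c. c < d \<Longrightarrow> residue_count d c js = residue_count d c js'"
  shows "e dvd (\<Sum>j\<leftarrow>js. q ^ j) \<longleftrightarrow> e dvd (\<Sum>j\<leftarrow>js'. q ^ j)"
proof -
  have "(\<Sum>c<d. q ^ c * residue_count d c js) = (\<Sum>c<d. q ^ c * residue_count d c js')"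
    using assms(3) by simp
  then show ?thesis
    using cong_sum_residue_count[OF assms(1,2)] cong_dvd_iff by metis
qed

text \<open>\<open>j\<close> is invertible modulo 5, so its multiples run through all residues; the
  twenty cases are checked one by one.\<close>

lemma residue_count_multiples_5:
  assumes "j \<in> {1, 2, 3, 4}" "c < 5"
  shows "residue_count 5 c [0, j, 2 * j, 3 * j, 4 * j] = 1"
proof -
  have "c \<in> {0, 1, 2, 3, 4}"
    using assms(2) by auto
  then show ?thesis
    using assms(1) by (elim insertE) simp_all
qed

(* If e divides 2 + q^j, then 2 + q^j, q^(2j) (2 + q^j) and the complement of their sum in
   twice the full sum 1 + q^j + ... + q^(4j) use every residue exactly twice. *)
lemma power_sum_family_5_2:
  assumes "q > 0" "e dvd (\<Sum>c<5. q ^ c)" "j \<in> {1, 2, 3, 4}" "e dvd 2 + q ^ j"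
  shows "power_sum_family q e 5 2 [[0, 0, j], [2 * j, 2 * j, 3 * j], [j, 3 * j, 4 * j, 4 * j]]"
proof -
  have "residue_count 5 c [0, j, 2 * j, 3 * j, 4 * j] = residue_count 5 c [0..<5]" if "c < 5" for c
    using residue_count_multiples_5[OF assms(3) that] residue_count_upt[OF that] by simp
  then have "e dvd (\<Sum>i\<leftarrow>[0, j, 2 * j, 3 * j, 4 * j]. q ^ i)"
    using cong_dvd_sum_mod[OF _ power_cong_1_of_sum_dvd[OF assms(2,1)], of "[0, j, 2 * j, 3 * j, 4 * j]" "[0..<5]"]
      assms(2) by (simp add: interv_sum_list_conv_sum_set_nat flip: atLeast0LessThan)
  moreover have "(\<Sum>i\<leftarrow>[0, j, 2 * j, 3 * j, 4 * j]. q ^ i) = 1 + q ^ j + q ^ (2 * j) + q ^ (3 * j) + q ^ (4 * j)"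
    by simp
  ultimately have full: "e dvd 2 * (1 + q ^ j + q ^ (2 * j) + q ^ (3 * j) + q ^ (4 * j))"
    by (metis dvd_mult)
  have eq: "q ^ (2 * j) + q ^ (2 * j) + q ^ (3 * j) = q ^ (2 * j) * (2 + q ^ j)"
    by (simp add: algebra_simps flip: power_add)
  have second: "e dvd q ^ (2 * j) + q ^ (2 * j) + q ^ (3 * j)"
    unfolding eq using assms(4) by (rule dvd_mult)
  have "2 * (1 + q ^ j + q ^ (2 * j) + q ^ (3 * j) + q ^ (4 * j)) =
      ((2 + q ^ j) + (q ^ (2 * j) + q ^ (2 * j) + q ^ (3 * j))) +
      (q ^ j + q ^ (3 * j) + q ^ (4 * j) + q ^ (4 * j))"
    by simp
  then have third: "e dvd q ^ j + q ^ (3 * j) + q ^ (4 * j) + q ^ (4 * j)"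
    using full second assms(4) by (metis dvd_add dvd_add_right_iff)
  have "residue_count 5 c (concat [[0, 0, j], [2 * j, 2 * j, 3 * j], [j, 3 * j, 4 * j, 4 * j]]) = 2"
    if "c < 5" for c
    using residue_count_multiples_5[OF assms(3) that] by simp
  then show ?thesis
    using second third assms(4) by (simp add: power_sum_family_def add_ac)
qed

text \<open>Since \<open>q ^ (5 * a)\<close> is 1 modulo \<open>e\<close>, multiplication by
  \<open>q ^ (4 * a)\<close> moves the two equal residues to 0. The value \<open>j = 0\<close> is
  not yet excluded here.\<close>

lemma exists_2_plus_power:
  fixes q e :: nat
  assumes "[q ^ 5 = 1] (mod e)" "e dvd q ^ a + q ^ b + q ^ c" "a mod 5 = b mod 5"
  shows "\<exists>j<5. e dvd 2 + q ^ j"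
proof -
  have "e dvd q ^ (4 * a) * (q ^ a + q ^ b + q ^ c)"
    using assms(2) by simp
  also have "q ^ (4 * a) * (q ^ a + q ^ b + q ^ c) = (\<Sum>j\<leftarrow>[4 * a + a, 4 * a + b, 4 * a + c]. q ^ j)"
    by (simp add: distrib_left add.assoc flip: power_add)
  finally have e: "e dvd \<dots>" .
  have "(4 * a + b) mod 5 = (4 * a + b mod 5) mod 5"
    by (simp add: mod_simps)
  also have "\<dots> = 0"
    unfolding assms(3)[symmetric] by (simp add: mod_simps)
  finally have "e dvd (\<Sum>j\<leftarrow>[0, 0, (4 * a + c) mod 5]. q ^ j)"
    using e cong_dvd_sum_mod[OF _ assms(1), of "[4 * a + a, 4 * a + b, 4 * a + c]" "[0, 0, (4 * a + c) mod 5]"]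
    by simp
  then show ?thesis
    by (intro exI[of _ "(4 * a + c) mod 5"]) (simp add: numeral_2_eq_2)
qed

lemma min_power_sum_3_imp:
  assumes "e > 0" "q > 0" "e dvd (\<Sum>c<5. q ^ c)" "\<not> [q = 1] (mod e)" "min_power_sum q e = 3"
  shows "\<exists>j\<in>{1, 2, 3, 4}. e dvd 2 + q ^ j"
proof -
  have q5: "[q ^ 5 = 1] (mod e)"
    using power_cong_1_of_sum_dvd assms by blast
  obtain js where js: "length js = 3" "e dvd (\<Sum>j\<leftarrow>js. q ^ j)"
    using min_power_sum_attained[OF assms(1), of q] assms(5) by metis
  obtain a b c where abc: "js = [a, b, c]"
    using length_eq_3E[OF js(1)] .
  have e: "e dvd q ^ a + q ^ b + q ^ c"
    using js abc by (simp add: add_ac)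
  have "a mod 5 = b mod 5 \<or> a mod 5 = c mod 5 \<or> b mod 5 = c mod 5"
  proof (rule ccontr)
    assume "\<not> ?thesis"
    then have S: "card {a mod 5, b mod 5, c mod 5} = 3" (is "card ?S = 3")
      by simp
    have "?S \<subseteq> {..<5}"
      by auto
    \<comment> \<open>If the three residues were distinct, removing them from the full sum would
      leave a relation of length 2, shorter than the minimum 3.\<close>
    then have "card ({..<5} - ?S) = 2"
      using S by (simp add: card_Diff_subset)
    then obtain x y where xy: "{..<5} - ?S = {x, y}" "x \<noteq> y"
      by (auto simp: card_2_iff)
    have "(\<Sum>c<5. q ^ c) = (\<Sum>c\<in>?S. q ^ c) + (\<Sum>c\<in>{x, y}. q ^ c)"
      unfolding xy(1)[symmetric] using \<open>?S \<subseteq> {..<5}\<close>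
      by (metis add.commute finite_lessThan sum.subset_diff)
    also have "(\<Sum>c\<in>?S. q ^ c) = q ^ (a mod 5) + q ^ (b mod 5) + q ^ (c mod 5)"
      using \<open>\<not> (a mod 5 = b mod 5 \<or> a mod 5 = c mod 5 \<or> b mod 5 = c mod 5)\<close> by (simp add: add_ac)
    finally have "e dvd q ^ (a mod 5) + q ^ (b mod 5) + q ^ (c mod 5) + (q ^ x + q ^ y)"
      using assms(3) xy(2) by simp
    moreover have "[q ^ (a mod 5) + q ^ (b mod 5) + q ^ (c mod 5) = q ^ a + q ^ b + q ^ c] (mod e)"
      by (intro cong_add cong_power_mod_exponent q5)
    then have "e dvd q ^ (a mod 5) + q ^ (b mod 5) + q ^ (c mod 5)"
      using e cong_dvd_iff by blast
    ultimately have "e dvd q ^ x + q ^ y"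
      by (simp add: dvd_add_right_iff)
    then show False
      using min_power_sum_le[of "[x, y]" e q] assms(5) by simp
  qed
  then obtain j where j: "j < 5" "e dvd 2 + q ^ j"
    using exists_2_plus_power[OF q5, of a b c] exists_2_plus_power[OF q5, of a c b]
      exists_2_plus_power[OF q5, of b c a] e by (auto simp: add_ac)
  \<comment> \<open>For \<open>j = 0\<close> the modulus divides 3. Modulo 3 the fifth powers of 0
    and 2 are 0 and 2, so \<open>q ^ 5\<close> being 1 leaves only \<open>q\<close> congruent to
    1.\<close>
  have "j \<noteq> 0"
  proof
    assume "j = 0"
    then have "e dvd 3"
      using j by (simp add: numeral_3_eq_3)
    then have e3: "e = 1 \<or> e = 3"
    proof -
      have "e \<in> {1, 2, 3}"
        using dvd_imp_le[OF \<open>e dvd 3\<close>] assms(1) by auto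
      then show ?thesis
        using \<open>e dvd 3\<close> by auto
    qed
    moreover have "q mod 3 = 1" if "e = 3"
    proof -
      have "(q mod 3) ^ 5 mod 3 = 1"
        using q5 that by (simp add: cong_def power_mod)
      moreover have "q mod 3 = 0 \<or> q mod 3 = 1 \<or> q mod 3 = 2"
        by linarith
      ultimately show ?thesis
        by auto
    qed
    ultimately show False
      using assms(4) by (auto simp: cong_def)
  qed
  then have "j \<in> {1, 2, 3, 4}"
    using j(1) by auto
  then show ?thesis
    using j(2) by blast
qed

text \<open>Write b = m s + r with r < m. The shifts of a shortest relation, repeated s times, give
  5 s relations within capacity m s, so floor(5 r / m) more must fit into capacity r. For m = 4 this
  is r, met by r full sums. For m = 3 and r = 0, 1, 2 it is 0, 1, 3; the last value exceeds the two
  full sums and needs \<open>power_sum_family_5_2\<close>.\<close>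

lemma power_sum_family_5:
  assumes "e > 0" "q > 0" "e dvd (\<Sum>c<5. q ^ c)" "\<not> [q = 1] (mod e)"
  shows "\<exists>jss. power_sum_family q e 5 b jss \<and> length jss = 5 * b div min_power_sum q e"
proof -
  define m where "m = min_power_sum q e"
  have q5: "[q ^ 5 = 1] (mod e)"
    using power_cong_1_of_sum_dvd assms by blast
  have "m \<noteq> 0" "m \<noteq> 1" "m \<noteq> 2" "m \<le> 5"
    unfolding m_def
    using min_power_sum_pos[OF assms(1), of q] min_power_sum_neq_1[OF assms(1) q5 _ assms(4)]
      min_power_sum_neq_2[OF assms(1) q5 _ assms(4)] min_power_sum_le_of_ones[OF _ assms(3)] by simp_all
  then consider "m = 3" | "m = 4" | "m = 5"
    by linarith
  then show ?thesis
  proof cases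
    case 3
    then show ?thesis
      using power_sum_family_of_ones[OF _ assms(3)] by (simp add: m_def)
  next
    case 2
    obtain js where js: "length js = m" "js \<noteq> []" "e dvd (\<Sum>j\<leftarrow>js. q ^ j)"
      using min_power_sum_attained[OF assms(1), of q] unfolding m_def by metis
    have "power_sum_family q e 5 (b div 4 * 4 + b mod 4 * 1)
        (concat (replicate (b div 4) (map (\<lambda>s. map ((+) s) js) [0..<5])) @
         concat (replicate (b mod 4) [[0..<5]]))"
      using power_sum_family_shifts[of 5 js e q] js 2 assms(3)
      by (intro power_sum_family_append power_sum_family_repeat power_sum_family_ones) auto
    moreover have "b div 4 * 4 + b mod 4 * 1 = b"
      by simp
    ultimately have "power_sum_family q e 5 b
        (concat (replicate (b div 4) (map (\<lambda>s. map ((+) s) js) [0..<5])) @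
         concat (replicate (b mod 4) [[0..<5]]))"
      by simp
    moreover have "b div 4 * 5 + b mod 4 = 5 * b div 4"
      by presburger
    ultimately show ?thesis
      using 2 unfolding m_def by (intro exI conjI) (auto simp: length_concat_replicate)
  next
    case 1
    obtain js where js: "length js = m" "js \<noteq> []" "e dvd (\<Sum>j\<leftarrow>js. q ^ j)"
      using min_power_sum_attained[OF assms(1), of q] unfolding m_def by metis
    obtain j where j: "j \<in> {1, 2, 3, 4}" "e dvd 2 + q ^ j"
      using min_power_sum_3_imp assms 1 unfolding m_def by blast
    have "\<exists>jss. power_sum_family q e 5 (b mod 3) jss \<and> length jss = 5 * (b mod 3) div 3"
    proof -
      consider "b mod 3 = 0" | "b mod 3 = 1" | "b mod 3 = 2"
        by linarith
      then show ?thesis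
      proof cases
        case 1
        then show ?thesis
          by (intro exI[of _ "[]"]) (simp add: power_sum_family_def)
      next
        case 2
        then show ?thesis
          using power_sum_family_ones[OF _ assms(3)] by (intro exI[of _ "[[0..<5]]"]) simp
      next
        case 3
        then show ?thesis
          using power_sum_family_5_2[OF assms(2,3) j] by (intro exI conjI) auto
      qed
    qed
    then obtain rest where rest: "power_sum_family q e 5 (b mod 3) rest" "length rest = 5 * (b mod 3) div 3"
      by blast
    have "power_sum_family q e 5 (b div 3 * 3 + b mod 3)
        (concat (replicate (b div 3) (map (\<lambda>s. map ((+) s) js) [0..<5])) @ rest)"
      using power_sum_family_shifts[of 5 js e q] js 1 rest
      by (intro power_sum_family_append power_sum_family_repeat) auto
    moreover have "b div 3 * 3 + b mod 3 = b"
      by simp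
    ultimately have "power_sum_family q e 5 b
        (concat (replicate (b div 3) (map (\<lambda>s. map ((+) s) js) [0..<5])) @ rest)"
      by simp
    moreover have "b div 3 * 5 + 5 * (b mod 3) div 3 = 5 * b div 3"
      by presburger
    ultimately show ?thesis
      using 1 rest(2) unfolding m_def by (intro exI conjI) (auto simp: length_concat_replicate)
  qed
qed

section \<open>Values of cyclotomic polynomials\<close>

text \<open>X^d - 1 has no root in common with its derivative, so over the complex numbers it is the
  product of distinct linear factors.\<close>

lemma prod_roots_of_unity:
  assumes "d > 0"
  shows "(\<Prod>z\<in>{z::complex. z ^ d = 1}. x - z) = x ^ d - 1"
proof -
  define p :: "complex poly" where "p = Polynomial.monom 1 d + [:- 1:]"
  have "degree p = d"
    unfolding p_def using assms by (subst degree_add_eq_left) (auto simp: degree_monom_eq)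
  then have "lead_coeff p = 1"
    using assms by (cases d) (auto simp: p_def)
  moreover have "rsquarefree p"
    using assms by (auto simp: rsquarefree_roots p_def pderiv_add pderiv_monom poly_monom pderiv_pCons power_0_left)
  ultimately have "(\<Prod>z | poly p z = 0. [:- z, 1:]) = p"
    using complex_poly_decompose_rsquarefree by fastforce
  then have "poly (\<Prod>z | poly p z = 0. [:- z, 1:]) x = poly p x"
    by simp
  moreover have "{z. poly p z = 0} = {z. z ^ d = 1}"
    by (auto simp: p_def poly_monom)
  ultimately show ?thesis
    by (simp add: poly_prod p_def poly_monom)
qed

text \<open>For prime \<open>d\<close> every root of unity except 1 is primitive: if z^d = z^k = 1
  with 0 < k < d, then Bezout gives z = 1. The factor \<open>x - 1\<close> restores the missing root
  and avoids a division.\<close>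

lemma poly_cyclotomic_prime:
  assumes "d \<in> {2, 3, 5}"
  shows "poly (cyclotomic d) x * (x - 1) = x ^ d - 1"
proof -
  have prime: "prime d"
    using assms by (auto simp: prime_nat_numeral_eq)
  have "(z ^ d = 1 \<and> (\<forall>k\<in>{1..<d}. z ^ k \<noteq> 1)) \<longleftrightarrow> z ^ d = 1 \<and> z \<noteq> 1" for z :: complex
  proof -
    have "z = 1" if zk: "z ^ d = 1" "z ^ k = 1" "k \<in> {1..<d}" for k
    proof -
      have "coprime k d"
        using prime_imp_coprime[of d k] prime nat_dvd_not_less[of k d] zk(3)
        by (auto simp: coprime_commute)
      then obtain a b where ab: "k * a = d * b + 1"
        using bezout_nat[of k d] zk(3) by (auto simp: coprime_iff_gcd_eq_1)
      have "z ^ (k * a) = 1" "z ^ (d * b) = 1"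
        using zk by (simp_all add: power_mult)
      then show ?thesis
        unfolding ab by simp
    qed
    moreover have "1 \<in> {1..<d}"
      using assms by auto
    ultimately show ?thesis
      by (metis power_one_right)
  qed
  then have "poly (cyclotomic d) x = (\<Prod>z\<in>{z::complex. z ^ d = 1} - {1}. x - z)"
    unfolding cyclotomic_def poly_prod by (intro prod.cong) auto
  moreover have "finite {z::complex. z ^ d = 1}"
    using assms finite_roots_unity[of d] by auto
  then have "(\<Prod>z\<in>{z::complex. z ^ d = 1}. x - z) = (x - 1) * (\<Prod>z\<in>{z::complex. z ^ d = 1} - {1}. x - z)"
    by (intro prod.remove) auto
  moreover have "(\<Prod>z\<in>{z::complex. z ^ d = 1}. x - z) = x ^ d - 1"
    using assms by (intro prod_roots_of_unity) auto
  ultimately show ?thesis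
    by (simp add: mult.commute)
qed

lemma poly_cyclotomic_1: "poly (cyclotomic 1) x = x - 1"
proof -
  have "{z::complex. z ^ 1 = 1 \<and> (\<forall>k\<in>{1..<1}. z ^ k \<noteq> 1)} = {1}"
    by auto
  then show ?thesis
    unfolding cyclotomic_def by simp
qed

lemma poly_cyclotomic_4: "poly (cyclotomic 4) x = x ^ 2 + 1"
proof -
  have "z ^ 4 = 1 \<and> (\<forall>k\<in>{1..<4}. z ^ k \<noteq> 1) \<longleftrightarrow> z = \<i> \<or> z = - \<i>" for z :: complex
  proof
    assume z: "z ^ 4 = 1 \<and> (\<forall>k\<in>{1..<4}. z ^ k \<noteq> 1)"
    \<comment> \<open>Primitivity rules out the first factor, which leaves z^2 = -1.\<close>
    have "(z ^ 2 - 1) * (z ^ 2 + 1) = z ^ 4 - 1"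
      by (simp add: algebra_simps flip: power_add)
    moreover have "z ^ 2 \<noteq> 1"
      using z by auto
    ultimately have "z ^ 2 + 1 = 0"
      using z by simp
    moreover have "(z - \<i>) * (z + \<i>) = z ^ 2 + 1"
      by (simp add: algebra_simps power2_eq_square)
    ultimately show "z = \<i> \<or> z = - \<i>"
      by (simp add: add_eq_0_iff2)
  next
    have "{1..<4} = {1, 2, 3::nat}"
      by auto
    moreover assume "z = \<i> \<or> z = - \<i>"
    ultimately show "z ^ 4 = 1 \<and> (\<forall>k\<in>{1..<4}. z ^ k \<noteq> 1)"
      by (elim disjE) (simp_all add: power2_eq_square power3_eq_cube power4_eq_xxxx complex_eq_iff)
  qed
  then have eq: "{z::complex. z ^ 4 = 1 \<and> (\<forall>k\<in>{1..<4}. z ^ k \<noteq> 1)} = {\<i>, - \<i>}"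
    by blast
  \<comment> \<open>Ensures that the product over the set has two factors.\<close>
  have "\<i> \<noteq> - \<i>"
    by (simp add: complex_eq_iff)
  then have "poly (cyclotomic 4) x = (x - \<i>) * (x + \<i>)"
    unfolding cyclotomic_def eq by (simp add: algebra_simps)
  then show ?thesis
    by (simp add: algebra_simps power2_eq_square)
qed

text \<open>The integers embed injectively into the complex numbers, so \<open>c\<close> is the
  integer value of the cyclotomic polynomial and the hypothesis becomes a divisibility of natural
  numbers.\<close>

lemma cyclotomic_dvd_cases:
  assumes "q > 1" "poly (cyclotomic d) (of_nat q) = of_int c" "int e dvd c" "d \<in> {1, 2, 3, 4, 5}"
  shows "[q = 1] (mod e) \<or> d \<in> {2, 3, 5} \<and> e dvd (\<Sum>i<d. q ^ i) \<or> d = 4 \<and> e dvd q ^ 2 + 1"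
proof -
  consider "d = 1" | "d = 4" | "d \<in> {2, 3, 5}"
    using assms(4) by auto
  then show ?thesis
  proof cases
    case 1
    have "of_int c = (of_int (int q - 1) :: complex)"
      using assms(2) poly_cyclotomic_1 1 by simp
    then have "c = int q - 1"
      by (simp only: of_int_eq_iff)
    then have "[int q = int 1] (mod int e)"
      using assms(3) by (simp add: cong_iff_dvd_diff)
    then show ?thesis
      using cong_int_iff by blast
  next
    case 2
    have "of_int c = (of_int (int (q ^ 2 + 1)) :: complex)"
      using assms(2) poly_cyclotomic_4 2 by (simp add: add.commute)
    then have "c = int (q ^ 2 + 1)"
      by (simp only: of_int_eq_iff)
    then have "e dvd q ^ 2 + 1"
      using assms(3) by (simp only: int_dvd_int_iff)
    then show ?thesis
      using 2 by blast
  next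
    case 3
    have "of_int (c * (int q - 1)) = (of_int (int q ^ d - 1) :: complex)"
      using assms(2) poly_cyclotomic_prime[OF 3, of "of_nat q"] by simp
    then have "c * (int q - 1) = int q ^ d - 1"
      by (simp only: of_int_eq_iff)
    also have "\<dots> = (int q - 1) * (\<Sum>i<d. int q ^ i)"
      by (rule power_diff_1_eq)
    \<comment> \<open>Cancels the factor \<open>int q - 1\<close>, nonzero because
      \<open>q > 1\<close>.\<close>
    finally have "c = int (\<Sum>i<d. q ^ i)"
      using assms(1) by simp
    then have "e dvd (\<Sum>i<d. q ^ i)"
      using assms(3) by (simp only: int_dvd_int_iff)
    then show ?thesis
      using 3 by blast
  qed
qed

section \<open>The Loewy length\<close>

text \<open>The \<open>d\<close> obtained is the order of \<open>q\<close> modulo \<open>e\<close>: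
  1 if \<open>q\<close> is congruent to 1, otherwise the given index. Being the order is what makes
  it divide \<open>n\<close>.\<close>

lemma exists_power_sum_family:
  assumes "q > 1" "e > 0" "[q ^ n = 1] (mod e)"
    and "[q = 1] (mod e) \<or> d \<in> {2, 3, 5} \<and> e dvd (\<Sum>i<d. q ^ i) \<or> d = 4 \<and> e dvd q ^ 2 + 1"
  obtains d k jss where "d > 0" "n = d * k" "[q ^ d = 1] (mod e)"
    "power_sum_family q e d (k * (q - 1)) jss" "length jss = d * k * (q - 1) div min_power_sum q e"
proof (cases "[q = 1] (mod e)")
  case True
  then show ?thesis
    using power_sum_family_div_1[OF assms(2) True, of "n * (q - 1)"] that[of 1 n] by auto
next
  case False
  have "d > 0 \<and> [q ^ d = 1] (mod e) \<and> d dvd n \<and>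
    (\<forall>b. \<exists>jss. power_sum_family q e d b jss \<and> length jss = d * b div min_power_sum q e)"
  proof (cases "d = 4")
    case True
    then have e: "e dvd q ^ 2 + 1"
      using assms(4) False by auto
    have "int q ^ 4 - 1 = (int q ^ 2 + 1) * (int q ^ 2 - 1)"
      by (simp add: algebra_simps flip: power_add)
    moreover have "int e dvd int q ^ 2 + 1"
      using e int_dvd_int_iff[of e "q ^ 2 + 1"] by (simp add: add.commute)
    ultimately have "int e dvd int q ^ 4 - 1"
      by simp
    then have "[int (q ^ 4) = int 1] (mod int e)"
      by (simp add: cong_iff_dvd_diff)
    then have q4: "[q ^ 4 = 1] (mod e)"
      by (simp only: cong_int_iff)
    \<comment> \<open>As q^2 = -1 modulo \<open>e\<close>, q^2 = 1 would give \<open>e dvd 2\<close>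
      and hence \<open>q\<close> congruent to 1. This leaves 4 as the only possible order.\<close>
    have "\<not> [q ^ 2 = 1] (mod e)"
    proof
      assume *: "[q ^ 2 = 1] (mod e)"
      then have "[q ^ 2 + 1 = 1 + 1] (mod e)"
        by (intro cong_add) auto
      then have "e dvd 1 + 1"
        using e cong_dvd_iff by blast
      then have "e dvd 2"
        by (simp only: one_add_one)
      then show False
        using cong_1_of_dvd_2[OF *] False by simp
    qed
    then have "\<not> ord e q dvd 2" "ord e q dvd 4"
      using q4 ord_divides by blast+
    moreover have "x = 4" if "\<not> x dvd 2" "x dvd 4" for x :: nat
    proof -
      have "x \<le> 4"
        using that by (intro dvd_imp_le) auto
      then consider "x = 0" | "x = 1" | "x = 2" | "x = 3" | "x = 4"
        by linarith
      then show ?thesis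
        using that by cases auto
    qed
    ultimately have "ord e q = 4"
      by blast
    then have "4 dvd n"
      using assms(3) ord_divides by metis
    then show ?thesis
      using True q4 power_sum_family_4[OF assms(2) e False q4] by simp
  next
    case d4: False
    then have d: "d \<in> {2, 3, 5}" and e: "e dvd (\<Sum>i<d. q ^ i)"
      using assms(4) False by auto
    have pos: "d > 0" and qd: "[q ^ d = 1] (mod e)"
      using d power_cong_1_of_sum_dvd[OF e] assms(1) by auto
    have "prime d"
      using d by (auto simp: prime_nat_numeral_eq)
    moreover have "ord e q \<noteq> 1"
      using False ord_divides[of q 1 e] by auto
    ultimately have "ord e q = d"
      using qd ord_divides prime_nat_iff by metis
    then have "d dvd n"
      using assms(3) ord_divides by blast
    moreover have "\<exists>jss. power_sum_family q e d b jss \<and> length jss = d * b div min_power_sum q e" for b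
    proof (cases "d = 5")
      case True
      then show ?thesis
        using power_sum_family_5[OF assms(2) _ _ False] e assms(1) by simp
    next
      case d5: False
      \<comment> \<open>For d = 2 the length 2 is the desired value; only d = 3 has to exclude
        it.\<close>
      have "min_power_sum q e \<noteq> 2" if "d = 3"
        using min_power_sum_neq_2[OF assms(2) qd _ False] that by simp
      moreover have "min_power_sum q e \<le> d"
        using min_power_sum_le_of_ones[OF pos e] .
      ultimately have "min_power_sum q e = d"
        using min_power_sum_neq_1[OF assms(2) qd pos False] min_power_sum_pos[OF assms(2), of q] d d5
        by auto
      then show ?thesis
        using power_sum_family_of_ones[OF pos e] by simp
    qed
    ultimately show ?thesis
      using pos qd by blast
  qed
  then show ?thesis
    using that by (metis dvdE mult.assoc)
qed

theorem proposition5p6: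
  fixes q n e m :: nat
  assumes "q > 1" and "n \<ge> 1" and "e \<ge> 1" and "e dvd q ^ n - 1"
    and "m = min_power_sum q e"
    and "\<exists>d\<in>{1, 2, 3, 4, 5}. \<exists>c::int. poly (cyclotomic d) (of_nat q) = of_int c \<and> int e dvd c"
  shows "int (loewy_length (alg_A q n e :: ((nat \<Rightarrow>\<^sub>0 nat) \<Rightarrow>\<^sub>0 'a::field) set ring)) =
    \<lfloor>real n * ((real q - 1) / real m)\<rfloor> + 1"
proof -
  obtain d c where d: "d \<in> {1, 2, 3, 4, 5}" "poly (cyclotomic d) (of_nat q) = of_int c" "int e dvd c"
    using assms(6) by blast
  have qn: "[q ^ n = 1] (mod e)"
    using assms(1,4) by (simp add: cong_altdef_nat)
  have e: "e > 0"
    using assms(3) by simp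
  \<comment> \<open>From here on \<open>d\<close> is the order of \<open>q\<close> modulo
    \<open>e\<close>, which may differ from the cyclotomic index.\<close>
  obtain d k jss where *: "d > 0" "n = d * k" "[q ^ d = 1] (mod e)"
    "power_sum_family q e d (k * (q - 1)) jss" "length jss = d * k * (q - 1) div min_power_sum q e"
    using exists_power_sum_family[OF assms(1) e qn cyclotomic_dvd_cases[OF assms(1) d(2,3,1)]] .
  have "loewy_length (alg_A q n e :: ((nat \<Rightarrow>\<^sub>0 nat) \<Rightarrow>\<^sub>0 'a) set ring) = Suc (n * (q - 1) div m)"
    unfolding *(2) assms(5) using assms(1)
    by (intro loewy_length_alg_A_family[OF _ e *(1,3,4,5)]) simp
  moreover have "real n * ((real q - 1) / real m) = real (n * (q - 1)) / real m"
    using assms(1) by (simp add: of_nat_diff)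
  ultimately show ?thesis
    by (simp only: floor_divide_of_nat_eq)
qed

end
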